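(* Let $\rho$ be a probability distribution on $\mathbb{R}^d\times\mathbb{R}$ with $\mathbb{E}\|a\|^2<\infty$ and $\mathbb{E}[b^2]<\infty$ for $(a,b)\sim\rho$, with $H=\mathbb{E}[aa^\top]$ invertible, and let $x_*$ be the unique minimizer of $\mathcal{R}(x)=\frac12\mathbb{E}_\rho(\langle x,a\rangle-b)^2$. Assume there are finite constants $\sigma,\kappa$ with (i) $\mathbb{E}[(b-\langle x_*,a\rangle)^2 aa^\top]\preccurlyeq \sigma^2 H$, and (ii) for every positive semidefinite matrix $M$, $\mathbb{E}[\langle a,Ma\rangle\, aa^\top]\preccurlyeq \kappa\,\mathrm{tr}(MH)\,H$. Run the algorithm AcSGD described in the context with step sizes $\alpha,\beta>0$ satisfying $\kappa(\alpha+2\beta)\mathrm{tr}(H)\le1$ and $\alpha\le\frac{\beta}{2\kappa d}$. Then for every integer $t\ge1$, the last iterate satisfies $$\mathbb{E}[\mathcal{R}(x_t)]-\mathcal{R}(x_* )\le \min\left\{\frac{3}{\alpha t^2},\frac{24}{\beta t}\right\}\|x_0-x_*\|^2+2\left((\alpha+2\beta)\mathrm{tr}(H)+\frac{2\alpha d}{\beta}\right)\sigma^2.$$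
   Context: $\preccurlyeq$ is the Loewner order on symmetric matrices. Samples $(a_t,b_t)_{t\ge0}$ are drawn i.i.d. from $\rho$. AcSGD: given $x_0\in\mathbb{R}^d$, set $z_0=x_0$ and for $t\ge0$ let $g_t=a_t(\langle a_t,x_t\rangle-b_t)$ and $y_{t+1}=x_t-\beta g_t$, $z_{t+1}=z_t-\alpha(t+1)g_t$, $(t+2)x_{t+1}=(t+1)y_{t+1}+z_{t+1}$. Expectation is over the samples. *)

theory Defs
  imports "HOL-Probability.Probability"
begin

definition outer :: "real^'n \<Rightarrow> real^'n^'n" where
  "outer a = (\<chi> i j. a$i * a$j)"

definition psd :: "real^'n^'n \<Rightarrow> bool" where
  "psd M \<longleftrightarrow> transpose M = M \<and> (\<forall>v. 0 \<le> v \<bullet> (M *v v))"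

definition loewner_le :: "real^'n^'n \<Rightarrow> real^'n^'n \<Rightarrow> bool" where
  "loewner_le A B \<longleftrightarrow> psd (B - A)"

definition risk :: "((real^'n) \<times> real) measure \<Rightarrow> real^'n \<Rightarrow> real" where
  "risk rho x = (1/2) * (\<integral>p. (x \<bullet> fst p - snd p)^2 \<partial>rho)"

definition Hmat :: "((real^'n) \<times> real) measure \<Rightarrow> real^'n^'n" where
  "Hmat rho = (\<integral>p. outer (fst p) \<partial>rho)"

text \<open>AcSGD state (x_t, y_t, z_t) driven by the sample sequence w (w t = (a_t, b_t)).
  y_0 is irrelevant for the recursion; we set it to x_0.\<close>
primrec acsgd_state :: "real \<Rightarrow> real \<Rightarrow> real^'n \<Rightarrow> (nat \<Rightarrow> (real^'n) \<times> real) \<Rightarrow> nat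
    \<Rightarrow> (real^'n) \<times> (real^'n) \<times> (real^'n)" where
  "acsgd_state \<alpha> \<beta> x0 w 0 = (x0, x0, x0)"
| "acsgd_state \<alpha> \<beta> x0 w (Suc t) =
    (let (x, y, z) = acsgd_state \<alpha> \<beta> x0 w t;
         a = fst (w t); b = snd (w t);
         g = (a \<bullet> x - b) *\<^sub>R a;
         y' = x - \<beta> *\<^sub>R g;
         z' = z - (\<alpha> * real (t + 1)) *\<^sub>R g;
         x' = (1 / real (t + 2)) *\<^sub>R (real (t + 1) *\<^sub>R y' + z')
     in (x', y', z'))"

definition acsgd_x :: "real \<Rightarrow> real \<Rightarrow> real^'n \<Rightarrow> (nat \<Rightarrow> (real^'n) \<times> real) \<Rightarrow> nat \<Rightarrow> real^'n" where
  "acsgd_x \<alpha> \<beta> x0 w t = fst (acsgd_state \<alpha> \<beta> x0 w t)"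

end

theory Submission
  imports Defs
begin

text \<open>
  Put \<open>u\<^sub>t = t (y\<^sub>t - x\<^sub>*)\<close> and take \<open>z\<^sub>t\<close> relative to \<open>x\<^sub>*\<close>; then \<open>(t + 1) (x\<^sub>t - x\<^sub>*) = u\<^sub>t + z\<^sub>t\<close> and the
  pair \<open>(u\<^sub>t, z\<^sub>t)\<close> follows a time-homogeneous random linear recursion with additive noise. By linearity
  it splits into a bias part (no noise) and a variance part (zero start); in each part the correlation of
  additive and multiplicative noise vanishes, since the variance part has mean zero. Work in an
  orthonormal eigenbasis of \<open>H\<close>. For an eigenvector \<open>e\<close>, the second moments of
  \<open>p \<langle>u\<^sub>t, e\<rangle> + q \<langle>z\<^sub>t, e\<rangle>\<close> satisfy a recursion that moves the coefficients \<open>(p, q)\<close> by the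
  transposed noiseless dynamics and adds \<open>(\<beta> p + \<alpha> q)\<^sup>2\<close> times the variance of the gradient along \<open>e\<close>.
  Assumptions (i) and (ii) bound that variance by the energy \<open>F\<^sub>t = E \<langle>u\<^sub>t + z\<^sub>t, H (u\<^sub>t + z\<^sub>t)\<rangle>\<close>, so
  unrolling yields the renewal inequality
  \<open>F\<^sub>t \<le> h\<^sub>t + \<Sum>k<t. g\<^sub>t\<^sub>-\<^sub>1\<^sub>-\<^sub>k (\<kappa> F\<^sub>k + (k + 1)\<^sup>2 \<sigma>\<^sup>2)\<close>.
  An exact Lyapunov function gives \<open>\<Sum>j. g\<^sub>j \<le> G = ((\<alpha> + 2 \<beta>) tr H + 2 \<alpha> d / \<beta>) / 3\<close>, and the step size
  conditions give \<open>\<kappa> G \<le> 2 / 3\<close>, so the inequality can be solved with loss of a factor 3.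
\<close>

section \<open>The dual recursion and the renewal inequality\<close>

text \<open>The transposed noiseless dynamics along an eigenvector with eigenvalue \<open>\<lambda>\<close>, in the parameters
  \<open>e = \<beta> \<lambda>\<close> and \<open>f = \<alpha> \<lambda>\<close>.\<close>

fun dual_step :: "real \<Rightarrow> real \<Rightarrow> real \<times> real \<Rightarrow> real \<times> real" where
  "dual_step e f (p, q) = (p - (e * p + f * q), q + (p - (e * p + f * q)))"

definition dual_iter :: "real \<Rightarrow> real \<Rightarrow> nat \<Rightarrow> real \<times> real" where
  "dual_iter e f j = (dual_step e f ^^ j) (1, 1)"

lemma dual_iter_0: "dual_iter e f 0 = (1, 1)"
  by (simp add: dual_iter_def)

lemma dual_iter_Suc: "dual_iter e f (Suc j) = dual_step e f (dual_iter e f j)"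
  by (simp add: dual_iter_def)

text \<open>\<open>Y\<close> is, up to the factor \<open>2 e D\<close>, the total forcing \<open>\<Sum>j. (e p\<^sub>j + f q\<^sub>j)\<^sup>2\<close> started from \<open>(p, q)\<close>,
  computed from the generating function of the recursion and written as a sum of squares.\<close>

lemma dual_iter_forcing_sum:
  assumes e: "0 < e" and f: "0 < f" and ef: "f + 2 * e \<le> 1"
  shows "(\<Sum>j<J. (e * fst (dual_iter e f j) + f * snd (dual_iter e f j))^2)
         \<le> (2 * f / e + f + 2 * e) / 3"
proof -
  define D where "D = 4 - f - 2 * e"
  define Y where "Y p q = D * f * p^2 + ((2 * e - f) * p + 2 * f * q)^2" for p q :: real
  define r where "r j = e * fst (dual_iter e f j) + f * snd (dual_iter e f j)" for j
  have D: "D \<ge> 3" using ef by (simp add: D_def)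
  have Ypos: "Y p q \<ge> 0" for p q using D f by (simp add: Y_def)
  have step: "Y p q - Y (p - (e * p + f * q)) (q + (p - (e * p + f * q))) = 2 * e * D * (e * p + f * q)^2"
    for p q
    unfolding Y_def D_def by algebra
  have "2 * e * D * (\<Sum>j<J. (r j)^2) = Y 1 1 - case_prod Y (dual_iter e f J)"
  proof (induction J)
    case 0
    then show ?case by (simp add: dual_iter_0)
  next
    case (Suc J)
    obtain p q where pq: "dual_iter e f J = (p, q)" by fastforce
    show ?case using Suc step[of p q]
      by (simp add: dual_iter_Suc pq r_def distrib_left)
  qed
  moreover have "case_prod Y (dual_iter e f J) \<ge> 0" using Ypos by (simp add: case_prod_beta)
  moreover have "Y 1 1 = 4 * f + 2 * e * f + 4 * e^2"
    unfolding Y_def D_def by (simp add: power2_eq_square algebra_simps)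
  ultimately have le: "2 * e * D * (\<Sum>j<J. (r j)^2) \<le> 4 * f + 2 * e * f + 4 * e^2" by linarith
  \<comment> \<open>The condition \<open>f + 2 * e \<le> 1\<close> makes \<open>D\<close> at least
    3; replacing \<open>D\<close> by 3 is the source of the denominator 3 in the bound.\<close>
  have "2 * e * 3 * (\<Sum>j<J. (r j)^2) \<le> 2 * e * D * (\<Sum>j<J. (r j)^2)"
    using D e by (intro mult_right_mono mult_left_mono sum_nonneg) auto
  with le have "6 * e * (\<Sum>j<J. (r j)^2) \<le> 4 * f + 2 * e * f + 4 * e^2" by linarith
  then have "(\<Sum>j<J. (r j)^2) \<le> (4 * f + 2 * e * f + 4 * e^2) / (6 * e)"
    using e by (simp add: field_simps)
  also have "\<dots> = (2 * f / e + f + 2 * e) / 3" using e by (simp add: field_simps power2_eq_square)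
  finally show ?thesis unfolding r_def .
qed

text \<open>In the variables \<open>q\<close> and \<open>z = (1 - e) p + e q\<close> the dual recursion is the noiseless
  accelerated scheme itself, \<open>z' = z - f q\<close> and \<open>q' = (1 - e) q + z'\<close>, so that Nesterov's Lyapunov
  function \<open>f (q - z)\<^sup>2 + z\<^sup>2\<close> applies.\<close>

lemma dual_iter_snd_bounds:
  assumes e: "0 < e" "e \<le> 1" and f: "0 < f" "f \<le> 1" and fe: "f + e^2 \<le> 2 * e"
  shows "f * (snd (dual_iter e f t))^2 \<le> 1" and "e * (snd (dual_iter e f t))^2 \<le> real t + 1"
proof -
  define q where "q t = snd (dual_iter e f t)" for t
  define z where "z t = (1 - e) * fst (dual_iter e f t) + e * snd (dual_iter e f t)" for t
  have z0: "z 0 = 1" and q0: "q 0 = 1" by (simp_all add: z_def q_def dual_iter_0)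
  have zS: "z (Suc t) = z t - f * q t" and qS: "q (Suc t) = (1 - e) * q t + z (Suc t)" for t
    by (cases "dual_iter e f t"; simp add: z_def q_def dual_iter_Suc algebra_simps)+
  define V where "V t = f * (q t - z t)^2 + (z t)^2" for t
  have V0: "V 0 = 1" by (simp add: V_def z0 q0)
  have "V (Suc t) - V t = f * (q t)^2 * (f + e^2 - 2 * e) - f * (z t)^2" for t
    unfolding V_def qS zS by algebra
  moreover have "f * (q t)^2 * (f + e^2 - 2 * e) \<le> 0" for t
    using fe f by (intro mult_nonneg_nonpos) auto
  ultimately have VS: "V (Suc t) \<le> V t - f * (z t)^2" for t by (smt (verit))
  \<comment> \<open>The gain occurs in the first step: \<open>z 0 = 1\<close> lowers
    \<open>V\<close> from 1 to at most \<open>1 - f\<close>. Later steps only need that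
    \<open>V\<close> does not increase.\<close>
  have V1: "V (Suc t) \<le> 1 - f" for t
  proof (induction t)
    case 0 show ?case using VS[of 0] by (simp add: V0 z0)
  next
    case (Suc t)
    have "0 \<le> f * (z (Suc t))^2" using f by simp
    with VS[of "Suc t"] Suc show ?case by linarith
  qed
  \<comment> \<open>Cauchy-Schwarz for \<open>q = (q - z) + z\<close> with the weights of
    \<open>V\<close>; the defect is a perfect square. Together with \<open>V1\<close> this gives
    \<open>(1 + f) * (1 - f) \<le> 1\<close>.\<close>
  have cs: "f * (q t)^2 \<le> (1 + f) * V t" for t
  proof -
    have "(1 + f) * V t - f * (q t)^2 = (f * (q t - z t) - z t)^2"
      unfolding V_def by algebra
    then show ?thesis using zero_le_power2[of "f * (q t - z t) - z t"] by linarith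
  qed
  show "f * (snd (dual_iter e f t))^2 \<le> 1"
  proof (cases t)
    case 0 then show ?thesis using f by (simp add: dual_iter_0)
  next
    case (Suc n)
    have "f * (q t)^2 \<le> (1 + f) * (1 - f)"
      using cs[of t] V1[of n] f by (smt (verit) Suc mult_left_mono)
    also have "\<dots> \<le> 1" by (simp add: algebra_simps)
    finally show ?thesis by (simp add: q_def)
  qed
  have z1: "\<bar>z t\<bar> \<le> 1" for t
  proof -
    have "V t \<le> 1" using V0 V1[of "t - 1"] f by (cases t) auto
    moreover have "(z t)^2 \<le> V t" using f by (simp add: V_def)
    ultimately show ?thesis by (simp flip: abs_square_le_1)
  qed
  \<comment> \<open>This scalar recursion yields two bounds: dropping the contraction,
    \<open>\<bar>q t\<bar>\<close> grows by at most 1 per step; keeping it,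
    \<open>\<bar>q t\<bar>\<close> never exceeds the fixed point \<open>1 / e\<close>. Their product
    bounds \<open>e * (q t)^2\<close>.\<close>
  have qstep: "\<bar>q (Suc t)\<bar> \<le> (1 - e) * \<bar>q t\<bar> + 1" for t
  proof -
    have "\<bar>q (Suc t)\<bar> \<le> \<bar>(1 - e) * q t\<bar> + \<bar>z (Suc t)\<bar>" unfolding qS by (rule abs_triangle_ineq)
    then show ?thesis using z1[of "Suc t"] e by (simp add: abs_mult)
  qed
  have q1: "\<bar>q t\<bar> \<le> real t + 1"
  proof (induction t)
    case (Suc t)
    have "(1 - e) * \<bar>q t\<bar> \<le> \<bar>q t\<bar>" using e by (simp add: mult_left_le_one_le)
    with Suc qstep[of t] show ?case by simp
  qed (simp add: q0)
  have q2: "e * \<bar>q t\<bar> \<le> 1"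
  proof (induction t)
    case (Suc t)
    have "e * \<bar>q (Suc t)\<bar> \<le> e * ((1 - e) * \<bar>q t\<bar> + 1)" using qstep e by simp
    also have "\<dots> = (1 - e) * (e * \<bar>q t\<bar>) + e" by (simp add: algebra_simps)
    also have "\<dots> \<le> (1 - e) * 1 + e" using Suc e by (intro add_right_mono mult_left_mono) auto
    finally show ?case by simp
  qed (simp add: q0 e)
  have "e * (q t)^2 = (e * \<bar>q t\<bar>) * \<bar>q t\<bar>" by (simp add: power2_eq_square)
  also have "\<dots> \<le> 1 * (real t + 1)" using q1 q2 e by (intro mult_mono) auto
  finally show "e * (snd (dual_iter e f t))^2 \<le> real t + 1" by (simp add: q_def)
qed

text \<open>Each step back in time advances the coefficients by one dual step. The forcing of time
  \<open>k\<close> enters on the passage from \<open>k\<close> to \<open>k + 1\<close>, when the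
  coefficients have moved \<open>t - Suc k\<close> times.\<close>

lemma dual_unroll:
  fixes Phi :: "nat \<Rightarrow> real \<Rightarrow> real \<Rightarrow> real" and n :: "nat \<Rightarrow> real"
  assumes step: "\<And>t p q. Phi (Suc t) p q
      = case_prod (Phi t) (dual_step (\<beta> * l) (\<alpha> * l) (p, q)) + (\<beta> * p + \<alpha> * q)^2 * n t"
  shows "Phi t 1 1 = case_prod (Phi 0) (dual_iter (\<beta> * l) (\<alpha> * l) t)
    + (\<Sum>k<t. (\<beta> * fst (dual_iter (\<beta> * l) (\<alpha> * l) (t - Suc k)) + \<alpha> * snd (dual_iter (\<beta> * l) (\<alpha> * l) (t - Suc k)))^2 * n k)"
proof -
  let ?d = "dual_iter (\<beta> * l) (\<alpha> * l)"
  let ?w = "\<lambda>i. (\<beta> * fst (?d i) + \<alpha> * snd (?d i))^2"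
  \<comment> \<open>Induction on the number \<open>j\<close> of steps already undone; the claim is
    the case \<open>j = t\<close>.\<close>
  have "j \<le> t \<Longrightarrow> Phi t 1 1 = case_prod (Phi (t - j)) (?d j) + (\<Sum>i<j. ?w i * n (t - Suc i))" for j
  proof (induction j)
    case 0
    then show ?case by (simp add: dual_iter_0)
  next
    case (Suc j)
    obtain p q where pq: "?d j = (p, q)" by fastforce
    have "t - j = Suc (t - Suc j)" using Suc by simp
    with Suc step[of "t - Suc j" p q] show ?case by (simp add: pq dual_iter_Suc)
  qed
  from this[of t] have "Phi t 1 1 = case_prod (Phi 0) (?d t) + (\<Sum>i<t. ?w i * n (t - Suc i))" by simp
  also have "(\<Sum>i<t. ?w i * n (t - Suc i)) = (\<Sum>k<t. ?w (t - Suc k) * n k)"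
    by (subst sum.nat_diff_reindex[symmetric]) (rule sum.cong, auto)
  finally show ?thesis .
qed

text \<open>The claimed bound reproduces itself under strong induction. Inserted into the
  convolution it returns with the factor \<open>\<kappa> * G \<le> 2 / 3\<close>, so the start
  contributes 1 + 2 = 3 times \<open>m t * A\<close>, and the noise 1 + 2 = 3 times
  \<open>G * s * (real t)^2\<close>.\<close>

lemma renewal_bound:
  fixes F g m :: "nat \<Rightarrow> real"
  assumes rec: "\<And>t. F t \<le> m t * A + (\<Sum>k<t. g (t - Suc k) * (\<kappa> * F k + (real k + 1)^2 * s))"
    and g: "\<And>j. g j \<ge> 0" and G: "\<And>J. (\<Sum>j<J. g j) \<le> G"
    and \<kappa>: "0 \<le> \<kappa>" "\<kappa> * G \<le> 2 / 3" and A: "0 \<le> A" and s: "0 \<le> s"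
    and m: "mono m" "\<And>t. 0 \<le> m t"
  shows "F t \<le> 3 * (m t * A) + 3 * G * s * (real t)^2"
proof (induction t rule: less_induct)
  case (less t)
  have G0: "0 \<le> G" using G[of 0] by simp
  \<comment> \<open>A common bound at the horizon \<open>t\<close> for all bracketed terms with
    \<open>k < t\<close>: \<open>m\<close> is monotone, and \<open>k + 1 \<le> t\<close> absorbs the
    shift in the noise term.\<close>
  define b where "b = \<kappa> * (3 * (m t * A) + 3 * G * s * (real t)^2) + (real t)^2 * s"
  have b0: "0 \<le> b" unfolding b_def using \<kappa> A s m G0 by simp
  have kb: "\<kappa> * F k + (real k + 1)^2 * s \<le> b" if k: "k < t" for k
  proof -
    have "F k \<le> 3 * (m k * A) + 3 * G * s * (real k)^2" using less k by simp
    also have "\<dots> \<le> 3 * (m t * A) + 3 * G * s * (real t)^2"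
      using k A s G0 monoD[OF m(1), of k t]
      by (intro add_mono mult_left_mono mult_right_mono power_mono) auto
    finally have "\<kappa> * F k \<le> \<kappa> * \<dots>" using \<kappa> by (intro mult_left_mono) auto
    moreover have "(real k + 1)^2 * s \<le> (real t)^2 * s"
      using k s by (intro mult_right_mono power_mono) auto
    ultimately show ?thesis unfolding b_def by linarith
  qed
  have "(\<Sum>k<t. g (t - Suc k) * (\<kappa> * F k + (real k + 1)^2 * s)) \<le> (\<Sum>k<t. g (t - Suc k) * b)"
    using kb g by (intro sum_mono mult_left_mono) auto
  also have "\<dots> = (\<Sum>k<t. g k) * b"
    by (simp only: sum_distrib_right[symmetric] sum.nat_diff_reindex)
  also have "\<dots> \<le> G * b" using G b0 by (intro mult_right_mono)
  also have "\<dots> = (\<kappa> * G) * (3 * (m t * A) + 3 * G * s * (real t)^2) + G * s * (real t)^2"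
    unfolding b_def by algebra
  also have "\<dots> \<le> (2/3) * (3 * (m t * A) + 3 * G * s * (real t)^2) + G * s * (real t)^2"
    using \<kappa> A s m G0 by (intro add_right_mono mult_right_mono) auto
  also have "\<dots> = 2 * (m t * A) + 3 * G * s * (real t)^2" by algebra
  finally show ?case using rec[of t] by linarith
qed

section \<open>Orthonormal eigenbases of symmetric operators\<close>

text \<open>A maximiser \<open>v\<close> of the Rayleigh quotient on the unit sphere of
  \<open>S\<close> is an eigenvector: by the first-order condition, \<open>h v\<close> is orthogonal
  to every vector of \<open>S\<close> orthogonal to \<open>v\<close>.\<close>

lemma symmetric_eigenvector_in_subspace:
  fixes h :: "'a::euclidean_space \<Rightarrow> 'a"
  assumes lin: "linear h" and sym: "\<And>x y. h x \<bullet> y = x \<bullet> h y"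
    and S: "subspace S" "h ` S \<subseteq> S" "S \<noteq> {0}"
  obtains v where "v \<in> S" "norm v = 1" "h v = (v \<bullet> h v) *\<^sub>R v"
proof -
  interpret h: linear h by fact
  let ?K = "S \<inter> sphere 0 1"
  have "compact ?K"
    using S(1) by (intro closed_Int_compact closed_subspace compact_sphere)
  moreover obtain y where y: "y \<in> S" "y \<noteq> 0" using S subspace_0 by blast
  then have "(inverse (norm y)) *\<^sub>R y \<in> ?K" using S(1) by (simp add: subspace_scale)
  then have "?K \<noteq> {}" by blast
  moreover have "continuous_on ?K (\<lambda>x. x \<bullet> h x)"
    using lin by (intro continuous_intros linear_continuous_on linear_conv_bounded_linear[THEN iffD1])
  ultimately obtain v where v: "v \<in> S" "norm v = 1"
    and max: "\<And>x. x \<in> S \<Longrightarrow> norm x = 1 \<Longrightarrow> x \<bullet> h x \<le> v \<bullet> h v"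
    using continuous_attains_sup[of ?K "\<lambda>x. x \<bullet> h x"] by (fastforce simp: Ball_def)
  have vv: "v \<bullet> v = 1" using v(2) by (simp add: dot_square_norm)
  define m where "m = v \<bullet> h v"
  have ray: "x \<bullet> h x \<le> m * (x \<bullet> x)" if "x \<in> S" for x
  proof (cases "x = 0")
    case False
    let ?c = "inverse (norm x)"
    have "(?c *\<^sub>R x) \<bullet> h (?c *\<^sub>R x) \<le> m"
      unfolding m_def using that False S(1) by (intro max) (auto simp: subspace_scale)
    then have "(x \<bullet> h x) / (norm x)^2 \<le> m"
      by (simp add: h.scaleR power2_eq_square field_simps)
    then show ?thesis using False by (simp add: dot_square_norm field_simps)
  qed (simp add: h.zero)
  have orth: "y \<bullet> h v = 0" if y: "y \<in> S" "v \<bullet> y = 0" for y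
  proof -
    define D where "D = m * (y \<bullet> y) - y \<bullet> h y"
    have D: "D \<ge> 0" using ray[OF y(1)] by (simp add: D_def)
    have key: "2 * (y \<bullet> h v) * c \<le> D * c^2" for c :: real
    proof -
      have "v + c *\<^sub>R y \<in> S" using v y S(1) by (simp add: subspace_add subspace_scale)
      note ray[OF this]
      also have "(v + c *\<^sub>R y) \<bullet> (v + c *\<^sub>R y) = 1 + c^2 * (y \<bullet> y)"
        using y(2) vv by (simp add: inner_add power2_eq_square inner_commute[of y v])
      finally have "(v + c *\<^sub>R y) \<bullet> h (v + c *\<^sub>R y) \<le> m * (1 + c^2 * (y \<bullet> y))" .
      also have "(v + c *\<^sub>R y) \<bullet> h (v + c *\<^sub>R y) = m + 2 * c * (y \<bullet> h v) + c^2 * (y \<bullet> h y)"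
        using sym[of v y] by (simp add: h.add h.scaleR inner_add m_def power2_eq_square
            algebra_simps inner_commute)
      finally show ?thesis by (simp add: D_def algebra_simps)
    qed
    \<comment> \<open>With this step size the perturbation inequality \<open>key\<close> reads
      \<open>(D + 2) * c^2 \<le> 0\<close>. The added 1 keeps the denominator positive when
      \<open>D = 0\<close>.\<close>
    define c where "c = (y \<bullet> h v) / (D + 1)"
    have c: "y \<bullet> h v = c * (D + 1)" using D by (simp add: c_def)
    have "2 * (c * (D + 1)) * c \<le> D * c^2" using key[of c] unfolding c .
    moreover have "2 * (c * (D + 1)) * c - D * c^2 = D * c^2 + 2 * c^2" by algebra
    moreover have "0 \<le> D * c^2" using D by simp
    ultimately have "c^2 \<le> 0" by linarith
    then show ?thesis by (simp add: c)
  qed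
  \<comment> \<open>The residual lies in \<open>S\<close> and is orthogonal to \<open>v\<close>,
    hence by \<open>orth\<close> to \<open>h v\<close> as well, and so to itself.\<close>
  let ?y = "h v - m *\<^sub>R v"
  have y: "?y \<in> S" "v \<bullet> ?y = 0"
    using v S by (auto simp: subspace_diff subspace_scale image_subset_iff inner_diff_right m_def dot_square_norm)
  have "?y \<bullet> ?y = ?y \<bullet> h v - m * (?y \<bullet> v)" by (simp only: inner_diff_right inner_scaleR_right)
  with orth[OF y] y(2) have "?y \<bullet> ?y = 0" by (simp only: inner_commute[of ?y v])
  then have "?y = 0" by simp
  then show thesis using that v m_def by auto
qed

text \<open>Spectral theorem by induction on the dimension: split off a unit eigenvector
  \<open>v\<close>; by symmetry its orthogonal complement is again invariant. The induction runs
  over all invariant subspaces.\<close>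

lemma symmetric_orthonormal_eigenbasis:
  fixes h :: "'a::euclidean_space \<Rightarrow> 'a"
  assumes lin: "linear h" and sym: "\<And>x y. h x \<bullet> y = x \<bullet> h y"
  obtains B where "pairwise orthogonal B" "\<And>e. e \<in> B \<Longrightarrow> norm e = 1" "span B = UNIV"
    "\<And>e. e \<in> B \<Longrightarrow> h e = (e \<bullet> h e) *\<^sub>R e"
proof -
  have "\<exists>B. pairwise orthogonal B \<and> (\<forall>e\<in>B. norm e = 1 \<and> h e = (e \<bullet> h e) *\<^sub>R e) \<and> span B = S"
    if "subspace S" "h ` S \<subseteq> S" for S
    using that
  proof (induction "dim S" arbitrary: S rule: less_induct)
    case less
    show ?case
    proof (cases "S = {0}")
      case True
      then show ?thesis by (intro exI[of _ "{}"]) auto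
    next
      case False
      obtain v where v: "v \<in> S" "norm v = 1" "h v = (v \<bullet> h v) *\<^sub>R v"
        using symmetric_eigenvector_in_subspace[OF lin sym less(2,3) False] by blast
      define S' where "S' = {x \<in> S. v \<bullet> x = 0}"
      have sub: "subspace S'"
        using less(2) unfolding S'_def subspace_def by (auto simp: inner_add_right)
      have "h ` S' \<subseteq> S'"
      proof
        fix y assume "y \<in> h ` S'"
        then obtain x where x: "x \<in> S" "v \<bullet> x = 0" "y = h x" by (auto simp: S'_def)
        have "v \<bullet> y = h v \<bullet> x" by (simp add: x sym)
        also have "\<dots> = 0" by (subst v(3)) (simp add: x)
        finally show "y \<in> S'" using x less(3) by (auto simp: S'_def)
      qed
      moreover have "dim S' < dim S"
      proof (rule dim_psubset)
        have "v \<notin> S'" using v by (auto simp: S'_def)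
        moreover have "S' \<subseteq> S" by (auto simp: S'_def)
        ultimately have "S' \<subset> S" using v(1) by blast
        then show "span S' \<subset> span S"
          using sub less(2) by (simp add: span_eq_iff[THEN iffD2])
      qed
      ultimately obtain B where B: "pairwise orthogonal B" "\<forall>e\<in>B. norm e = 1 \<and> h e = (e \<bullet> h e) *\<^sub>R e"
        "span B = S'" using less(1)[OF _ sub] by blast
      have Bo: "orthogonal v e" if "e \<in> B" for e
        using that B(3) span_superset[of B] by (auto simp: S'_def orthogonal_def)
      have "span (insert v B) = S"
      proof
        show "span (insert v B) \<subseteq> S"
          using v B(3) span_superset[of B] less(2) by (intro span_minimal) (auto simp: S'_def)
        show "S \<subseteq> span (insert v B)"
        proof
          fix x assume x: "x \<in> S"
          have "x - (v \<bullet> x) *\<^sub>R v \<in> S'"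
            using x v less(2) by (simp add: S'_def subspace_diff subspace_scale inner_diff_right dot_square_norm)
          then show "x \<in> span (insert v B)" using B(3) by (auto simp: span_insert)
        qed
      qed
      then show ?thesis using B v Bo
        by (intro exI[of _ "insert v B"]) (auto simp: pairwise_insert orthogonal_commute)
    qed
  qed
  from this[of UNIV] show thesis using that by auto
qed

text \<open>Sums over \<open>B\<close> replace coordinates: Parseval recovers norms and quadratic
  forms, and the cardinality turns a constant summed over \<open>B\<close> into a multiple of the
  dimension.\<close>

lemma
  fixes B :: "'a::euclidean_space set"
  assumes B: "pairwise orthogonal B" "\<And>e. e \<in> B \<Longrightarrow> norm e = 1" "span B = UNIV"
  shows orthonormal_finite: "finite B"
    and orthonormal_card: "card B = DIM('a)"
    and orthonormal_inner: "x \<bullet> y = (\<Sum>e\<in>B. (x \<bullet> e) * (y \<bullet> e))"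
proof -
  have "0 \<notin> B" using B(2) by fastforce
  then have ind: "independent B" using B(1) by (rule pairwise_orthogonal_independent[rotated])
  show fin: "finite B" using ind independent_imp_finite by blast
  have "card B = dim (UNIV :: 'a set)"
    using ind B(3) by (metis dim_span_eq_card_independent)
  then show "card B = DIM('a)" by simp
  have ee: "e \<bullet> f = (if e = f then 1 else 0)" if "e \<in> B" "f \<in> B" for e f
    using B(1,2) that by (auto simp: pairwise_def orthogonal_def dot_square_norm)
  have exp: "x = (\<Sum>e\<in>B. (x \<bullet> e) *\<^sub>R e)" for x
  proof -
    have "x \<in> span B" using B by simp
    then obtain u where u: "x = (\<Sum>e\<in>B. u e *\<^sub>R e)" using fin by (auto simp: span_finite)
    have "x \<bullet> f = u f" if "f \<in> B" for f
      using that fin by (simp add: u inner_sum_left ee if_distrib cong: if_cong)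
    then show ?thesis using u by (metis (no_types, lifting) sum.cong)
  qed
  show "x \<bullet> y = (\<Sum>e\<in>B. (x \<bullet> e) * (y \<bullet> e))"
    by (subst exp[of x], simp only: inner_sum_left inner_scaleR_left) (simp add: inner_commute)
qed

section \<open>The accelerated process\<close>

lemma norm_sum_le:
  fixes \<theta> :: "'a::real_normed_vector \<times> 'a"
  shows "(norm (fst \<theta> + snd \<theta>))^2 \<le> 2 * (norm \<theta>)^2" "(norm (snd \<theta>))^2 \<le> (norm \<theta>)^2"
    "(norm (fst \<theta>))^2 \<le> (norm \<theta>)^2"
proof -
  have n: "(norm \<theta>)^2 = (norm (fst \<theta>))^2 + (norm (snd \<theta>))^2" by (simp add: norm_prod_def)
  have "(norm (fst \<theta> + snd \<theta>))^2 \<le> (norm (fst \<theta>) + norm (snd \<theta>))^2"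
    by (intro power_mono norm_triangle_ineq) auto
  also have "\<dots> \<le> 2 * (norm \<theta>)^2"
    unfolding n using sum_squares_bound[of "norm (fst \<theta>)" "norm (snd \<theta>)"] by (simp add: power2_sum)
  finally show "(norm (fst \<theta> + snd \<theta>))^2 \<le> 2 * (norm \<theta>)^2" .
qed (simp_all add: norm_prod_def)

lemma norm_add_square_le: "(norm (x + y))^2 \<le> 2 * (norm x)^2 + 2 * (norm y)^2" for x y :: "'a::real_normed_vector"
  using norm_sum_le(1)[of "(x, y)"] by (simp add: norm_prod_def)

lemma abs_le_one_add_square: "\<bar>x\<bar> \<le> 1 + x^2" for x :: real
  using sum_squares_bound[of 1 "\<bar>x\<bar>"] by simp

text \<open>In \<open>proc c v\<close> the first component is \<open>u\<^sub>t\<close> and the second \<open>z\<^sub>t\<close>. The switch \<open>c\<close> scales the additive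
  noise: \<open>c = 0\<close> with \<open>v = x\<^sub>0 - x\<^sub>*\<close> is the bias part, \<open>c = 1\<close> with \<open>v = 0\<close> the variance part.
  The gradient carries the factor \<open>t + 1\<close>, which makes the recursion homogeneous in time.\<close>

locale accelerated_lsq = prob_space M for M :: "'b measure" +
  fixes a :: "'b \<Rightarrow> 'a::euclidean_space" and \<eta> :: "'b \<Rightarrow> real"
    and B :: "'a set" and lam :: "'a \<Rightarrow> real" and \<alpha> \<beta> \<kappa> \<sigma> :: real
  assumes a_meas [measurable]: "a \<in> borel_measurable M"
    and eta_meas [measurable]: "\<eta> \<in> borel_measurable M"
    and a_moment: "integrable M (\<lambda>x. norm (a x) ^ 4)"
    and noise_moment: "integrable M (\<lambda>x. (\<eta> x)^2 * (norm (a x))^2)"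
    and B: "pairwise orthogonal B" "\<And>e. e \<in> B \<Longrightarrow> norm e = 1" "span B = UNIV"
    and eigen: "\<And>e s. e \<in> B \<Longrightarrow> (\<integral>x. (a x \<bullet> s) * (a x \<bullet> e) \<partial>M) = lam e * (s \<bullet> e)"
    and noise_mean: "\<And>e. e \<in> B \<Longrightarrow> (\<integral>x. \<eta> x * (a x \<bullet> e) \<partial>M) = 0"
    and kurtosis: "\<And>e s. e \<in> B \<Longrightarrow>
      (\<integral>x. (a x \<bullet> s)^2 * (a x \<bullet> e)^2 \<partial>M) \<le> \<kappa> * lam e * (\<Sum>f\<in>B. lam f * (s \<bullet> f)^2)"
    and noise: "\<And>e. e \<in> B \<Longrightarrow> (\<integral>x. (\<eta> x)^2 * (a x \<bullet> e)^2 \<partial>M) \<le> \<sigma>^2 * lam e"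
    and lam_pos: "\<And>e. e \<in> B \<Longrightarrow> 0 < lam e"
begin

lemma total_mass: "measure M (space M) = 1"
  by (rule prob_space)

sublocale sequence_space M ..

text \<open>One integrable majorant for everything quadratic in the gradient: the multiplicative
  noise is of order \<open>norm (a x) ^ 4\<close>, the additive noise of order
  \<open>(\<eta> x)^2 * (norm (a x))^2\<close>, and the 1 covers constants and first
  moments.\<close>

definition envelope :: "'b \<Rightarrow> real" where
  "envelope x = 1 + norm (a x) ^ 4 + (\<eta> x)^2 * (norm (a x))^2"

lemma envelope_ge: "1 \<le> envelope x" "norm (a x) ^ 4 \<le> envelope x" "(\<eta> x)^2 * (norm (a x))^2 \<le> envelope x"
  by (simp_all add: envelope_def add_increasing2 add_increasing)

lemma envelope_integrable: "integrable M envelope"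
  unfolding envelope_def using a_moment noise_moment by (intro Bochner_Integration.integrable_add) auto

lemma envelope_meas [measurable]: "envelope \<in> borel_measurable M"
  using envelope_integrable by (rule borel_measurable_integrable)

lemma integrable_dominated:
  fixes f :: "'b \<Rightarrow> 'c::{banach, second_countable_topology}"
  assumes [measurable]: "f \<in> borel_measurable M" and "\<And>x. norm (f x) \<le> C * envelope x"
  shows "integrable M f"
proof (rule Bochner_Integration.integrable_bound)
  show "integrable M (\<lambda>x. C * envelope x)" using envelope_integrable by simp
  show "AE x in M. norm (f x) \<le> norm (C * envelope x)"
    using assms(2) by (auto intro!: always_eventually order_trans[OF _ abs_ge_self])
qed fact

definition grad :: "real \<Rightarrow> nat \<Rightarrow> 'a \<times> 'a \<Rightarrow> 'b \<Rightarrow> 'a" where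
  "grad c t \<theta> x = (a x \<bullet> (fst \<theta> + snd \<theta>) - c * (real t + 1) * \<eta> x) *\<^sub>R a x"

definition step :: "real \<Rightarrow> nat \<Rightarrow> 'a \<times> 'a \<Rightarrow> 'b \<Rightarrow> 'a \<times> 'a" where
  "step c t \<theta> x = (fst \<theta> + snd \<theta> - \<beta> *\<^sub>R grad c t \<theta> x, snd \<theta> - \<alpha> *\<^sub>R grad c t \<theta> x)"

primrec proc :: "real \<Rightarrow> 'a \<Rightarrow> (nat \<Rightarrow> 'b) \<Rightarrow> nat \<Rightarrow> 'a \<times> 'a" where
  "proc c v w 0 = (0, v)"
| "proc c v w (Suc t) = step c t (proc c v w t) (w t)"

lemma fst_snd_meas [measurable]:
  "(fst :: 'a \<times> 'a \<Rightarrow> 'a) \<in> borel_measurable borel" "(snd :: 'a \<times> 'a \<Rightarrow> 'a) \<in> borel_measurable borel"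
  by (intro borel_measurable_continuous_onI continuous_intros)+

lemma grad_meas [measurable]: "case_prod (grad c t) \<in> borel_measurable (borel \<Otimes>\<^sub>M M)"
  unfolding grad_def case_prod_beta by measurable

lemma step_meas [measurable]: "case_prod (step c t) \<in> borel_measurable (borel \<Otimes>\<^sub>M M)"
  unfolding step_def case_prod_beta by measurable

lemma proc_meas [measurable]: "(\<lambda>w. proc c v w t) \<in> borel_measurable S"
proof (induction t)
  case (Suc t)
  note Suc [measurable]
  have "(\<lambda>w. case_prod (step c t) (proc c v w t, w t)) \<in> borel_measurable S" by measurable
  then show ?case by simp
qed simp

section \<open>Independence of the state and the next sample\<close>

lemma proc_cong: "(\<And>i. i < t \<Longrightarrow> w i = w' i) \<Longrightarrow> proc c v w t = proc c v w' t"
  by (induction t) auto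

text \<open>Independence is obtained by splicing two independent sequences at position
  \<open>t\<close>: the state at time \<open>t\<close> reads only the first one, and sample
  \<open>t\<close> is entry 0 of the second.\<close>

lemma proc_pair_law:
  "distr S (borel \<Otimes>\<^sub>M M) (\<lambda>w. (proc c v w t, w t)) = distr S borel (\<lambda>w. proc c v w t) \<Otimes>\<^sub>M M"
proof -
  let ?X = "\<lambda>w. proc c v w t"
  have "distr S (borel \<Otimes>\<^sub>M M) (\<lambda>w. (?X w, w t))
      = distr (distr (S \<Otimes>\<^sub>M S) S (\<lambda>(\<omega>, \<omega>'). comb_seq t \<omega> \<omega>')) (borel \<Otimes>\<^sub>M M) (\<lambda>w. (?X w, w t))"
    by (simp add: PiM_comb_seq)
  also have "\<dots> = distr (S \<Otimes>\<^sub>M S) (borel \<Otimes>\<^sub>M M) (\<lambda>(\<omega>, \<omega>'). (?X \<omega>, \<omega>' 0))"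
  proof (subst distr_distr)
    have "?X (comb_seq t \<omega> \<omega>') = ?X \<omega>" "comb_seq t \<omega> \<omega>' t = \<omega>' 0" for \<omega> \<omega>'
      by (auto intro!: proc_cong simp: comb_seq_def)
    then show "distr (S \<Otimes>\<^sub>M S) (borel \<Otimes>\<^sub>M M) ((\<lambda>w. (?X w, w t)) \<circ> (\<lambda>(\<omega>, \<omega>'). comb_seq t \<omega> \<omega>'))
        = distr (S \<Otimes>\<^sub>M S) (borel \<Otimes>\<^sub>M M) (\<lambda>(\<omega>, \<omega>'). (?X \<omega>, \<omega>' 0))"
      by (intro distr_cong) (auto simp: case_prod_beta comp_def)
    show "(\<lambda>(\<omega>, \<omega>'). comb_seq t \<omega> \<omega>') \<in> measurable (S \<Otimes>\<^sub>M S) S" by (rule measurable_comb_seq)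
    show "(\<lambda>w. (?X w, w t)) \<in> measurable S (borel \<Otimes>\<^sub>M M)" by measurable
  qed
  also have "\<dots> = distr S borel ?X \<Otimes>\<^sub>M distr S M (\<lambda>w. w 0)"
  proof (rule pair_measure_distr[symmetric])
    show "sigma_finite_measure (distr S M (\<lambda>w. w 0))"
      by (intro prob_space_imp_sigma_finite P.prob_space_distr) measurable
  qed measurable
  also have "distr S M (\<lambda>w. w 0) = M"
    using PiM_component[of 0] by simp
  finally show ?thesis .
qed

text \<open>Conditioning on the state: the fresh sample is integrated out first. The growth bound
  and the second moment of the state provide the joint integrability for Fubini.\<close>

lemma expectation_split:
  fixes F :: "'a \<times> 'a \<Rightarrow> 'b \<Rightarrow> real"
  assumes F [measurable]: "case_prod F \<in> borel_measurable (borel \<Otimes>\<^sub>M M)"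
    and bound: "\<And>\<theta> x. \<bar>F \<theta> x\<bar> \<le> C * (1 + (norm \<theta>)^2) * envelope x"
    and mom: "integrable S (\<lambda>w. (norm (proc c v w t))^2)"
  shows "integrable S (\<lambda>w. F (proc c v w t) (w t))"
    and "(\<integral>w. F (proc c v w t) (w t) \<partial>S) = (\<integral>w. (\<integral>x. F (proc c v w t) x \<partial>M) \<partial>S)"
    and "integrable S (\<lambda>w. \<integral>x. F (proc c v w t) x \<partial>M)"
proof -
  let ?N = "distr S borel (\<lambda>w. proc c v w t)"
  interpret N: prob_space ?N by (intro P.prob_space_distr) measurable
  interpret NM: pair_sigma_finite ?N M ..
  have momN: "integrable ?N (\<lambda>\<theta>. (norm \<theta>)^2)"
    using mom by (subst integrable_distr_eq) auto
  have meas: "case_prod F \<in> borel_measurable (?N \<Otimes>\<^sub>M M)" by measurable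
  have "integrable (?N \<Otimes>\<^sub>M M) (\<lambda>(\<theta>, x). C * (1 + (norm \<theta>)^2) * envelope x)"
  proof (rule NM.Fubini_integrable)
    show "(\<lambda>(\<theta>, x). C * (1 + (norm \<theta>)^2) * envelope x) \<in> borel_measurable (?N \<Otimes>\<^sub>M M)" by measurable
    have "(\<lambda>\<theta>. \<integral>x. norm (case (\<theta>, x) of (\<theta>, x) \<Rightarrow> C * (1 + (norm \<theta>)^2) * envelope x) \<partial>M)
        = (\<lambda>\<theta>. (1 + (norm \<theta>)^2) * (\<bar>C\<bar> * (\<integral>x. \<bar>envelope x\<bar> \<partial>M)))"
      by (auto simp: abs_mult mult_ac fun_eq_iff)
    then show "integrable ?N (\<lambda>\<theta>. \<integral>x. norm (case (\<theta>, x) of (\<theta>, x) \<Rightarrow> C * (1 + (norm \<theta>)^2) * envelope x) \<partial>M)"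
      by (rule ssubst[where P = "integrable ?N"])
        (intro integrable_mult_left Bochner_Integration.integrable_add momN, simp)
  qed (use envelope_integrable in auto)
  then have int: "integrable (?N \<Otimes>\<^sub>M M) (case_prod F)"
    using meas
    by (rule Bochner_Integration.integrable_bound)
       (use bound in \<open>force intro!: always_eventually order_trans[OF _ abs_ge_self]\<close>)
  have int': "integrable (distr S (borel \<Otimes>\<^sub>M M) (\<lambda>w. (proc c v w t, w t))) (case_prod F)"
    using int by (simp only: proc_pair_law)
  show "integrable S (\<lambda>w. F (proc c v w t) (w t))"
    using int' by (subst (asm) integrable_distr_eq) auto
  have inner: "(\<lambda>\<theta>. \<integral>x. F \<theta> x \<partial>M) \<in> borel_measurable borel"
    by measurable
  have "integrable ?N (\<lambda>\<theta>. \<integral>x. case_prod F (\<theta>, x) \<partial>M)" using int by (rule NM.integrable_fst')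
  then show "integrable S (\<lambda>w. \<integral>x. F (proc c v w t) x \<partial>M)"
    using inner by (subst (asm) integrable_distr_eq) auto
  have "(\<integral>w. F (proc c v w t) (w t) \<partial>S)
      = integral\<^sup>L (distr S (borel \<Otimes>\<^sub>M M) (\<lambda>w. (proc c v w t, w t))) (case_prod F)"
    by (subst integral_distr) auto
  also have "\<dots> = integral\<^sup>L (?N \<Otimes>\<^sub>M M) (case_prod F)" by (simp only: proc_pair_law)
  also have "\<dots> = (\<integral>\<theta>. (\<integral>x. case_prod F (\<theta>, x) \<partial>M) \<partial>?N)" using int by (rule NM.integral_fst'[symmetric])
  also have "\<dots> = (\<integral>w. (\<integral>x. F (proc c v w t) x \<partial>M) \<partial>S)"
    using inner by (subst integral_distr) auto
  finally show "(\<integral>w. F (proc c v w t) (w t) \<partial>S) = (\<integral>w. (\<integral>x. F (proc c v w t) x \<partial>M) \<partial>S)" .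
qed

section \<open>Finite second moments of the process\<close>

lemma grad_bound: "(norm (grad c t \<theta> x))^2 \<le> (4 + 2 * (c * (real t + 1))^2) * (1 + (norm \<theta>)^2) * envelope x"
proof -
  let ?s = "fst \<theta> + snd \<theta>" and ?k = "c * (real t + 1)"
  have "grad c t \<theta> x = (a x \<bullet> ?s) *\<^sub>R a x + (- ?k * \<eta> x) *\<^sub>R a x"
    by (simp add: grad_def algebra_simps)
  then have "(norm (grad c t \<theta> x))^2 \<le> 2 * (norm ((a x \<bullet> ?s) *\<^sub>R a x))^2 + 2 * (norm ((- ?k * \<eta> x) *\<^sub>R a x))^2"
    by (metis norm_add_square_le)
  also have "(norm ((a x \<bullet> ?s) *\<^sub>R a x))^2 \<le> norm (a x) ^ 4 * (norm ?s)^2"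
  proof -
    have "(norm ((a x \<bullet> ?s) *\<^sub>R a x))^2 = \<bar>a x \<bullet> ?s\<bar>^2 * (norm (a x))^2" by (simp add: power_mult_distrib)
    also have "\<dots> \<le> (norm (a x) * norm ?s)^2 * (norm (a x))^2"
      by (intro mult_right_mono power_mono Cauchy_Schwarz_ineq2) auto
    also have "\<dots> = norm (a x) ^ 4 * (norm ?s)^2" by algebra
    finally show ?thesis .
  qed
  also have "norm (a x) ^ 4 * (norm ?s)^2 \<le> envelope x * (2 * (norm \<theta>)^2)"
    using envelope_ge norm_sum_le[of \<theta>] by (intro mult_mono) (auto intro: order_trans[OF _ envelope_ge(1)])
  also have "(norm ((- ?k * \<eta> x) *\<^sub>R a x))^2 = ?k^2 * ((\<eta> x)^2 * (norm (a x))^2)"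
    by (simp add: power_mult_distrib)
  also have "\<dots> \<le> ?k^2 * envelope x"
    using envelope_ge by (intro mult_left_mono) auto
  finally have "(norm (grad c t \<theta> x))^2 \<le> 2 * (envelope x * (2 * (norm \<theta>)^2)) + 2 * (?k^2 * envelope x)" by simp
  moreover have "(4 + 2 * ?k^2) * (1 + (norm \<theta>)^2) * envelope x - (2 * (envelope x * (2 * (norm \<theta>)^2)) + 2 * (?k^2 * envelope x))
      = 4 * envelope x + 2 * ?k^2 * (norm \<theta>)^2 * envelope x" by (simp add: algebra_simps)
  moreover have "0 \<le> 4 * envelope x + 2 * ?k^2 * (norm \<theta>)^2 * envelope x"
    using envelope_ge(1)[of x] by simp
  ultimately show ?thesis by linarith
qed

lemma step_bound:
  obtains K where "0 \<le> K" "\<And>\<theta> x. (norm (step c t \<theta> x))^2 \<le> K * (1 + (norm \<theta>)^2) * envelope x"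
proof
  let ?g = "4 + 2 * (c * (real t + 1))^2"
  let ?K = "6 + 2 * (\<alpha>^2 + \<beta>^2) * ?g"
  show "0 \<le> ?K" by simp
  fix \<theta> x
  let ?G = "grad c t \<theta> x"
  have "(norm (step c t \<theta> x))^2 = (norm (fst \<theta> + snd \<theta> + (- \<beta>) *\<^sub>R ?G))^2 + (norm (snd \<theta> + (- \<alpha>) *\<^sub>R ?G))^2"
    by (simp add: step_def norm_prod_def)
  also have "\<dots> \<le> (2 * (norm (fst \<theta> + snd \<theta>))^2 + 2 * (norm ((- \<beta>) *\<^sub>R ?G))^2)
      + (2 * (norm (snd \<theta>))^2 + 2 * (norm ((- \<alpha>) *\<^sub>R ?G))^2)"
    by (intro add_mono norm_add_square_le)
  also have "\<dots> = 2 * (norm (fst \<theta> + snd \<theta>))^2 + 2 * (norm (snd \<theta>))^2 + 2 * (\<alpha>^2 + \<beta>^2) * (norm ?G)^2"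
    by (simp add: power_mult_distrib algebra_simps)
  also have "\<dots> \<le> 6 * (norm \<theta>)^2 + 2 * (\<alpha>^2 + \<beta>^2) * (?g * (1 + (norm \<theta>)^2) * envelope x)"
  proof -
    have "2 * (norm (fst \<theta> + snd \<theta>))^2 + 2 * (norm (snd \<theta>))^2 \<le> 6 * (norm \<theta>)^2"
      using norm_sum_le[of \<theta>] by linarith
    then show ?thesis by (intro add_mono mult_left_mono grad_bound) auto
  qed
  also have "6 * (norm \<theta>)^2 \<le> 6 * ((1 + (norm \<theta>)^2) * envelope x)"
    using mult_mono[of "(norm \<theta>)^2" "1 + (norm \<theta>)^2" 1 "envelope x"] envelope_ge(1)[of x] by simp
  finally show "(norm (step c t \<theta> x))^2 \<le> ?K * (1 + (norm \<theta>)^2) * envelope x"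
    by (simp add: algebra_simps)
qed

lemma proc_moment: "integrable S (\<lambda>w. (norm (proc c v w t))^2)"
proof (induction t)
  case (Suc t)
  obtain K where K: "0 \<le> K" "\<And>\<theta> x. (norm (step c t \<theta> x))^2 \<le> K * (1 + (norm \<theta>)^2) * envelope x"
    using step_bound by metis
  have "(\<lambda>(\<theta>, x). (norm (step c t \<theta> x))^2) = (\<lambda>z. (norm (case_prod (step c t) z))^2)"
    by (simp add: fun_eq_iff)
  also have "\<dots> \<in> borel_measurable (borel \<Otimes>\<^sub>M M)" by measurable
  finally show ?case
    using expectation_split(1)[of "\<lambda>\<theta> x. (norm (step c t \<theta> x))^2" K c v t] K Suc by simp
qed simp

lemma proc_integrable_quadratic:
  assumes [measurable]: "f \<in> borel_measurable borel" and "\<And>\<theta>. \<bar>f \<theta>\<bar> \<le> C * (1 + (norm \<theta>)^2)"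
  shows "integrable S (\<lambda>w. f (proc c v w t) :: real)"
proof (rule Bochner_Integration.integrable_bound)
  show "integrable S (\<lambda>w. C * (1 + (norm (proc c v w t))^2))" using proc_moment by simp
  show "AE w in S. norm (f (proc c v w t)) \<le> norm (C * (1 + (norm (proc c v w t))^2))"
    unfolding real_norm_def by (intro always_eventually allI order_trans[OF assms(2) abs_ge_self])
qed measurable

section \<open>Integrability of the moments of one sample\<close>

lemma B_bound: "e \<in> B \<Longrightarrow> \<bar>x \<bullet> e\<bar> \<le> norm x"
  using Cauchy_Schwarz_ineq2[of x e] B(2) by simp

lemma B_bound_square: "e \<in> B \<Longrightarrow> (x \<bullet> e)^2 \<le> (norm x)^2"
  using power_mono[OF B_bound, of e x 2] by simp

lemma norm_square_le_envelope: "(norm (a x))^2 \<le> envelope x"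
proof -
  have "2 * (norm (a x))^2 \<le> 1 + norm (a x) ^ 4"
    using sum_squares_bound[of 1 "(norm (a x))^2"] by simp
  moreover have "0 \<le> (norm (a x))^2" by simp
  ultimately show ?thesis unfolding envelope_def by (smt (verit) mult_nonneg_nonneg zero_le_power2)
qed

lemma quadratic_integrable: "e \<in> B \<Longrightarrow> integrable M (\<lambda>x. (a x \<bullet> s) * (a x \<bullet> e))"
proof (rule integrable_dominated[where C = "norm s"])
  fix x assume e: "e \<in> B"
  have "norm ((a x \<bullet> s) * (a x \<bullet> e)) \<le> (norm (a x) * norm s) * norm (a x)"
    unfolding real_norm_def abs_mult using B_bound[OF e, of "a x"]
    by (intro mult_mono Cauchy_Schwarz_ineq2) auto
  also have "\<dots> = norm s * (norm (a x))^2" by (simp add: power2_eq_square)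
  also have "\<dots> \<le> norm s * envelope x" using norm_square_le_envelope by (intro mult_left_mono) auto
  finally show "norm ((a x \<bullet> s) * (a x \<bullet> e)) \<le> norm s * envelope x" .
qed measurable

lemma noise_integrable: "e \<in> B \<Longrightarrow> integrable M (\<lambda>x. \<eta> x * (a x \<bullet> e))"
proof (rule integrable_dominated[where C = 1])
  fix x assume e: "e \<in> B"
  have "norm (\<eta> x * (a x \<bullet> e)) \<le> \<bar>\<eta> x\<bar> * norm (a x)"
    unfolding real_norm_def abs_mult using B_bound[OF e, of "a x"] by (intro mult_left_mono) auto
  also have "\<dots> \<le> 1 + (\<eta> x)^2 * (norm (a x))^2"
    using abs_le_one_add_square[of "\<eta> x * norm (a x)"] by (simp add: power_mult_distrib abs_mult)
  also have "\<dots> \<le> 1 * envelope x" by (simp add: envelope_def)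
  finally show "norm (\<eta> x * (a x \<bullet> e)) \<le> 1 * envelope x" .
qed measurable

lemma quartic_integrable: "e \<in> B \<Longrightarrow> integrable M (\<lambda>x. (a x \<bullet> s)^2 * (a x \<bullet> e)^2)"
proof (rule integrable_dominated[where C = "(norm s)^2"])
  fix x assume e: "e \<in> B"
  have "\<bar>a x \<bullet> s\<bar>^2 * (a x \<bullet> e)^2 \<le> (norm (a x) * norm s)^2 * (norm (a x))^2"
    by (intro mult_mono B_bound_square[OF e] power_mono Cauchy_Schwarz_ineq2) auto
  also have "\<dots> = (norm s)^2 * norm (a x) ^ 4" by algebra
  also have "\<dots> \<le> (norm s)^2 * envelope x" using envelope_ge by (intro mult_left_mono) auto
  finally show "norm ((a x \<bullet> s)^2 * (a x \<bullet> e)^2) \<le> (norm s)^2 * envelope x" by simp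
qed measurable

lemma noise_square_integrable: "e \<in> B \<Longrightarrow> integrable M (\<lambda>x. (\<eta> x)^2 * (a x \<bullet> e)^2)"
proof (rule integrable_dominated[where C = 1])
  fix x assume e: "e \<in> B"
  have "(\<eta> x)^2 * (a x \<bullet> e)^2 \<le> (\<eta> x)^2 * (norm (a x))^2"
    using B_bound_square[OF e] by (intro mult_left_mono) auto
  also have "\<dots> \<le> envelope x" by (rule envelope_ge)
  finally show "norm ((\<eta> x)^2 * (a x \<bullet> e)^2) \<le> 1 * envelope x" by simp
qed measurable

text \<open>The integrand is of order \<open>\<bar>\<eta> x\<bar> * norm (a x) ^ 3\<close>, which
  the arithmetic-geometric mean inequality splits into the two moments in
  \<open>envelope\<close>.\<close>

lemma cross_integrable: "e \<in> B \<Longrightarrow> integrable M (\<lambda>x. (\<eta> x * (a x \<bullet> e)^2) *\<^sub>R a x)"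
proof (rule integrable_dominated[where C = 1])
  fix x assume e: "e \<in> B"
  have "norm ((\<eta> x * (a x \<bullet> e)^2) *\<^sub>R a x) \<le> \<bar>\<eta> x\<bar> * (norm (a x))^2 * norm (a x)"
    using B_bound_square[OF e, of "a x"] by (auto simp: abs_mult intro!: mult_left_mono mult_right_mono)
  also have "\<dots> = (\<bar>\<eta> x\<bar> * norm (a x)) * (norm (a x))^2" by simp
  also have "\<dots> \<le> (\<eta> x)^2 * (norm (a x))^2 + norm (a x) ^ 4"
  proof -
    let ?y = "\<bar>\<eta> x\<bar> * norm (a x)" and ?z = "(norm (a x))^2"
    have "2 * ?y * ?z \<le> ?y^2 + ?z^2" by (rule sum_squares_bound)
    moreover have "0 \<le> ?y * ?z" by simp
    ultimately have "?y * ?z \<le> ?y^2 + ?z^2" by linarith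
    then show ?thesis by (simp add: power_mult_distrib)
  qed
  also have "\<dots> \<le> 1 * envelope x" by (simp add: envelope_def)
  finally show "norm ((\<eta> x * (a x \<bullet> e)^2) *\<^sub>R a x) \<le> 1 * envelope x" .
qed measurable

section \<open>Moments of the gradient for a fixed state\<close>

lemma grad_meas' [measurable]: "grad c t \<theta> \<in> borel_measurable M"
  unfolding grad_def by measurable

lemma grad_inner: "grad c t \<theta> x \<bullet> e
    = (a x \<bullet> (fst \<theta> + snd \<theta>)) * (a x \<bullet> e) - c * (real t + 1) * (\<eta> x * (a x \<bullet> e))"
  by (simp add: grad_def algebra_simps)

lemma grad_integrable: "e \<in> B \<Longrightarrow> integrable M (\<lambda>x. grad c t \<theta> x \<bullet> e)"
  unfolding grad_inner
  by (intro Bochner_Integration.integrable_diff integrable_mult_right quadratic_integrable noise_integrable)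

lemma grad_mean: "e \<in> B \<Longrightarrow> (\<integral>x. grad c t \<theta> x \<bullet> e \<partial>M) = lam e * ((fst \<theta> + snd \<theta>) \<bullet> e)"
  unfolding grad_inner
  by (subst Bochner_Integration.integral_diff)
    (auto intro!: integrable_mult_right quadratic_integrable noise_integrable simp: eigen noise_mean)

lemma grad_inner_square: "(grad c t \<theta> x \<bullet> e)^2
    = (a x \<bullet> (fst \<theta> + snd \<theta>))^2 * (a x \<bullet> e)^2
      - 2 * (c * (real t + 1)) * ((fst \<theta> + snd \<theta>) \<bullet> ((\<eta> x * (a x \<bullet> e)^2) *\<^sub>R a x))
      + (c * (real t + 1))^2 * ((\<eta> x)^2 * (a x \<bullet> e)^2)"
proof -
  have eq: "(fst \<theta> + snd \<theta>) \<bullet> ((\<eta> x * (a x \<bullet> e)^2) *\<^sub>R a x)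
      = (\<eta> x * (a x \<bullet> e)^2) * (a x \<bullet> (fst \<theta> + snd \<theta>))" by (simp only: inner_scaleR_right inner_commute)
  show ?thesis unfolding grad_inner eq by algebra
qed

lemma grad_square_integrable: "e \<in> B \<Longrightarrow> integrable M (\<lambda>x. (grad c t \<theta> x \<bullet> e)^2)"
  unfolding grad_inner_square
  by (intro Bochner_Integration.integrable_diff Bochner_Integration.integrable_add integrable_mult_right
      integrable_inner_right quartic_integrable noise_square_integrable cross_integrable)

text \<open>The correlation of additive and multiplicative noise along \<open>e\<close>. As a vector
  it is independent of the state, so the mixed term is linear in the state and only the mean of the
  state matters for it.\<close>

definition cross :: "'a \<Rightarrow> 'a" where
  "cross e = (\<integral>x. (\<eta> x * (a x \<bullet> e)^2) *\<^sub>R a x \<partial>M)"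

text \<open>Expanding the square separates multiplicative noise, mixed term and additive noise. The
  first and last are bounded by \<open>kurtosis\<close> and \<open>noise\<close>; the mixed term has
  no definite sign and is kept exactly, to be averaged over the state later.\<close>

lemma grad_square_le:
  assumes e: "e \<in> B"
  shows "(\<integral>x. (grad c t \<theta> x \<bullet> e)^2 \<partial>M) \<le> \<kappa> * lam e * (\<Sum>f\<in>B. lam f * ((fst \<theta> + snd \<theta>) \<bullet> f)^2)
    - 2 * (c * (real t + 1)) * ((fst \<theta> + snd \<theta>) \<bullet> cross e) + (c * (real t + 1))^2 * (\<sigma>^2 * lam e)"
proof -
  let ?s = "fst \<theta> + snd \<theta>" and ?k = "c * (real t + 1)"
  have i1: "integrable M (\<lambda>x. (a x \<bullet> ?s)^2 * (a x \<bullet> e)^2)"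
    and i2: "integrable M (\<lambda>x. 2 * ?k * (?s \<bullet> ((\<eta> x * (a x \<bullet> e)^2) *\<^sub>R a x)))"
    and i3: "integrable M (\<lambda>x. ?k^2 * ((\<eta> x)^2 * (a x \<bullet> e)^2))"
    using e by (intro integrable_mult_right integrable_inner_right quartic_integrable
        noise_square_integrable cross_integrable; assumption)+
  have "(\<integral>x. (grad c t \<theta> x \<bullet> e)^2 \<partial>M)
      = (\<integral>x. (a x \<bullet> ?s)^2 * (a x \<bullet> e)^2 \<partial>M) - (\<integral>x. 2 * ?k * (?s \<bullet> ((\<eta> x * (a x \<bullet> e)^2) *\<^sub>R a x)) \<partial>M)
        + (\<integral>x. ?k^2 * ((\<eta> x)^2 * (a x \<bullet> e)^2) \<partial>M)"
    unfolding grad_inner_square using i1 i2 i3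
    by (simp only: Bochner_Integration.integral_add Bochner_Integration.integral_diff
        Bochner_Integration.integrable_diff)
  also have "(\<integral>x. 2 * ?k * (?s \<bullet> ((\<eta> x * (a x \<bullet> e)^2) *\<^sub>R a x)) \<partial>M) = 2 * ?k * (?s \<bullet> cross e)"
    unfolding cross_def integral_mult_right_zero
    by (subst integral_inner_right) (use cross_integrable[OF e] in auto)
  also have "(\<integral>x. ?k^2 * ((\<eta> x)^2 * (a x \<bullet> e)^2) \<partial>M) \<le> ?k^2 * (\<sigma>^2 * lam e)"
    unfolding integral_mult_right_zero by (intro mult_left_mono noise e) simp
  finally show ?thesis using kurtosis[OF e, of ?s] by linarith
qed

definition fluct :: "'a \<Rightarrow> real \<Rightarrow> nat \<Rightarrow> 'a \<times> 'a \<Rightarrow> 'b \<Rightarrow> real" where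
  "fluct e c t \<theta> x = grad c t \<theta> x \<bullet> e - lam e * ((fst \<theta> + snd \<theta>) \<bullet> e)"

lemma fluct_meas: "case_prod (fluct e c t) \<in> borel_measurable (borel \<Otimes>\<^sub>M M)"
  unfolding fluct_def grad_def case_prod_beta by measurable

lemma fluct_moments:
  assumes e: "e \<in> B"
  shows "integrable M (fluct e c t \<theta>)" "(\<integral>x. fluct e c t \<theta> x \<partial>M) = 0"
    "integrable M (\<lambda>x. (fluct e c t \<theta> x)^2)"
    "(\<integral>x. (fluct e c t \<theta> x)^2 \<partial>M) \<le> (\<integral>x. (grad c t \<theta> x \<bullet> e)^2 \<partial>M)"
proof -
  let ?m = "lam e * ((fst \<theta> + snd \<theta>) \<bullet> e)"
  note i = grad_integrable[OF e, of c t \<theta>] grad_square_integrable[OF e, of c t \<theta>]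
  show "integrable M (fluct e c t \<theta>)" unfolding fluct_def using i by simp
  show "(\<integral>x. fluct e c t \<theta> x \<partial>M) = 0"
    unfolding fluct_def using i by (simp add: grad_mean[OF e] total_mass)
  have sq: "(fluct e c t \<theta> x)^2 = (grad c t \<theta> x \<bullet> e)^2 - 2 * ?m * (grad c t \<theta> x \<bullet> e) + ?m^2" for x
    unfolding fluct_def by algebra
  show "integrable M (\<lambda>x. (fluct e c t \<theta> x)^2)" unfolding sq using i
    by (intro Bochner_Integration.integrable_diff Bochner_Integration.integrable_add integrable_mult_right) auto
  have "(\<integral>x. (fluct e c t \<theta> x)^2 \<partial>M) = (\<integral>x. (grad c t \<theta> x \<bullet> e)^2 \<partial>M) - 2 * ?m * ?m + ?m^2"
    unfolding sq using i by (simp add: grad_mean[OF e] total_mass)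
  also have "\<dots> = (\<integral>x. (grad c t \<theta> x \<bullet> e)^2 \<partial>M) - ?m^2" by algebra
  finally show "(\<integral>x. (fluct e c t \<theta> x)^2 \<partial>M) \<le> (\<integral>x. (grad c t \<theta> x \<bullet> e)^2 \<partial>M)" by simp
qed

text \<open>The duality behind the argument: testing the new state with \<open>(p, q)\<close>
  amounts to testing the old state with the coefficients moved by \<open>dual_step\<close>, up to
  centred noise.\<close>

lemma step_component:
  "p * (fst (step c t \<theta> x) \<bullet> e) + q * (snd (step c t \<theta> x) \<bullet> e)
    = (case dual_step (\<beta> * lam e) (\<alpha> * lam e) (p, q) of (p', q') \<Rightarrow> p' * (fst \<theta> \<bullet> e) + q' * (snd \<theta> \<bullet> e))
      - (\<beta> * p + \<alpha> * q) * fluct e c t \<theta> x"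
  by (simp add: step_def fluct_def inner_add_left inner_diff_left) algebra

section \<open>Moments of the process along an eigenvector\<close>

definition second_moment :: "real \<Rightarrow> 'a \<Rightarrow> 'a \<Rightarrow> nat \<Rightarrow> real \<Rightarrow> real \<Rightarrow> real" where
  "second_moment c v e t p q = (\<integral>w. (p * (fst (proc c v w t) \<bullet> e) + q * (snd (proc c v w t) \<bullet> e))^2 \<partial>S)"

definition first_moment :: "real \<Rightarrow> 'a \<Rightarrow> 'a \<Rightarrow> nat \<Rightarrow> real \<Rightarrow> real \<Rightarrow> real" where
  "first_moment c v e t p q = (\<integral>w. (p * (fst (proc c v w t) \<bullet> e) + q * (snd (proc c v w t) \<bullet> e)) \<partial>S)"

definition fluct_level :: "real \<Rightarrow> 'a \<Rightarrow> 'a \<Rightarrow> nat \<Rightarrow> real" where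
  "fluct_level c v e t = (\<integral>w. (\<integral>x. (fluct e c t (proc c v w t) x)^2 \<partial>M) \<partial>S)"

text \<open>For \<open>c = 1\<close> and \<open>v\<close> the initial error this is
  \<open>2 * (t + 1)^2\<close> times the expected excess risk, because the first and second
  components add up to \<open>t + 1\<close> times the error of the iterate.\<close>

definition energy :: "real \<Rightarrow> 'a \<Rightarrow> nat \<Rightarrow> real" where
  "energy c v t = (\<integral>w. (\<Sum>f\<in>B. lam f * ((fst (proc c v w t) + snd (proc c v w t)) \<bullet> f)^2) \<partial>S)"

lemma component_square_le:
  assumes "e \<in> B"
  shows "(p * (fst \<theta> \<bullet> e) + q * (snd \<theta> \<bullet> e))^2 \<le> 2 * (p^2 + q^2) * (norm \<theta>)^2"
proof -
  have "(p * (fst \<theta> \<bullet> e) + q * (snd \<theta> \<bullet> e))^2 \<le> 2 * (p * (fst \<theta> \<bullet> e))^2 + 2 * (q * (snd \<theta> \<bullet> e))^2"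
    using sum_squares_bound[of "p * (fst \<theta> \<bullet> e)" "q * (snd \<theta> \<bullet> e)"] by (simp add: power2_sum)
  also have "\<dots> = 2 * (p^2 * (fst \<theta> \<bullet> e)^2) + 2 * (q^2 * (snd \<theta> \<bullet> e)^2)" by (simp add: power_mult_distrib)
  also have "\<dots> \<le> 2 * (p^2 * (norm \<theta>)^2) + 2 * (q^2 * (norm \<theta>)^2)"
    by (intro add_mono mult_left_mono order_trans[OF B_bound_square[OF assms]] norm_sum_le) auto
  finally show ?thesis by (simp add: algebra_simps)
qed

lemma component_square_integrable:
  assumes "e \<in> B"
  shows "integrable S (\<lambda>w. (p * (fst (proc c v w t) \<bullet> e) + q * (snd (proc c v w t) \<bullet> e))^2)"
proof (rule proc_integrable_quadratic[where C = "2 * (p^2 + q^2)"])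
  fix \<theta> :: "'a \<times> 'a"
  have "2 * (p^2 + q^2) * (1 + (norm \<theta>)^2) = 2 * (p^2 + q^2) + 2 * (p^2 + q^2) * (norm \<theta>)^2"
    by (simp only: distrib_left mult_1_right)
  moreover have "0 \<le> 2 * (p^2 + q^2)" by simp
  ultimately show "\<bar>(p * (fst \<theta> \<bullet> e) + q * (snd \<theta> \<bullet> e))^2\<bar> \<le> 2 * (p^2 + q^2) * (1 + (norm \<theta>)^2)"
    using component_square_le[OF assms, of p \<theta> q] by (simp only: abs_of_nonneg[OF zero_le_power2])
qed measurable

lemma component_integrable:
  assumes "e \<in> B"
  shows "integrable S (\<lambda>w. p * (fst (proc c v w t) \<bullet> e) + q * (snd (proc c v w t) \<bullet> e))"
  by (rule P.square_integrable_imp_integrable[OF _ component_square_integrable[OF assms]]) measurable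

lemma moments_Suc:
  assumes e: "e \<in> B"
  shows second_moment_Suc: "second_moment c v e (Suc t) p q
      = case_prod (second_moment c v e t) (dual_step (\<beta> * lam e) (\<alpha> * lam e) (p, q))
        + (\<beta> * p + \<alpha> * q)^2 * fluct_level c v e t"
    and first_moment_Suc: "first_moment c v e (Suc t) p q
      = case_prod (first_moment c v e t) (dual_step (\<beta> * lam e) (\<alpha> * lam e) (p, q))"
    and fluct_level_integrable: "integrable S (\<lambda>w. \<integral>x. (fluct e c t (proc c v w t) x)^2 \<partial>M)"
proof -
  obtain p' q' where d: "dual_step (\<beta> * lam e) (\<alpha> * lam e) (p, q) = (p', q')" by fastforce
  let ?L = "\<lambda>\<theta>. p' * (fst \<theta> \<bullet> e) + q' * (snd \<theta> \<bullet> e)" and ?r = "\<beta> * p + \<alpha> * q"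
  let ?F = "\<lambda>\<theta> x. p * (fst (step c t \<theta> x) \<bullet> e) + q * (snd (step c t \<theta> x) \<bullet> e)"
  have F: "?F \<theta> x = ?L \<theta> - ?r * fluct e c t \<theta> x" for \<theta> x unfolding step_component d by simp
  note mf [measurable] = fluct_meas[of e c t]
  have Fm: "(\<lambda>(\<theta>, x). ?F \<theta> x) \<in> borel_measurable (borel \<Otimes>\<^sub>M M)"
    unfolding step_def grad_def case_prod_beta by measurable
  have F2m: "(\<lambda>(\<theta>, x). (?F \<theta> x)^2) \<in> borel_measurable (borel \<Otimes>\<^sub>M M)"
    unfolding step_def grad_def case_prod_beta by measurable
  obtain K where K: "0 \<le> K" "\<And>\<theta> x. (norm (step c t \<theta> x))^2 \<le> K * (1 + (norm \<theta>)^2) * envelope x"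
    using step_bound by metis
  let ?P = "2 * (p^2 + q^2)"
  have F2: "(?F \<theta> x)^2 \<le> ?P * K * (1 + (norm \<theta>)^2) * envelope x" for \<theta> x
  proof -
    have "(?F \<theta> x)^2 \<le> ?P * (norm (step c t \<theta> x))^2" by (rule component_square_le[OF e])
    also have "\<dots> \<le> ?P * (K * (1 + (norm \<theta>)^2) * envelope x)" by (intro mult_left_mono K) simp
    finally show ?thesis by (simp add: mult_ac)
  qed
  have one: "1 \<le> (1 + (norm \<theta>)^2) * envelope x" for \<theta> :: "'a \<times> 'a" and x
    using mult_mono[of 1 "1 + (norm \<theta>)^2" 1 "envelope x"] envelope_ge(1) by simp
  have F1: "\<bar>?F \<theta> x\<bar> \<le> (1 + ?P * K) * (1 + (norm \<theta>)^2) * envelope x" for \<theta> x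
  proof -
    have "\<bar>?F \<theta> x\<bar> \<le> 1 + (?F \<theta> x)^2"
      by (rule abs_le_one_add_square)
    also have "\<dots> \<le> (1 + (norm \<theta>)^2) * envelope x + ?P * K * (1 + (norm \<theta>)^2) * envelope x"
      by (intro add_mono one F2)
    finally show ?thesis by (simp add: algebra_simps)
  qed
  note fm = fluct_moments[OF e, of c t]
  have "first_moment c v e (Suc t) p q = (\<integral>w. (\<integral>x. ?F (proc c v w t) x \<partial>M) \<partial>S)"
    unfolding first_moment_def proc.simps by (rule expectation_split(2)[OF Fm F1 proc_moment])
  also have "(\<lambda>w. \<integral>x. ?F (proc c v w t) x \<partial>M) = (\<lambda>w. ?L (proc c v w t))"
    unfolding F using fm by (simp add: total_mass)
  finally show "first_moment c v e (Suc t) p q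
      = case_prod (first_moment c v e t) (dual_step (\<beta> * lam e) (\<alpha> * lam e) (p, q))"
    unfolding d by (simp add: first_moment_def)
  have bf: "\<bar>(fluct e c t \<theta> x)^2\<bar> \<le> 2 * ((4 + 2 * (c * (real t + 1))^2) + 2 * (lam e)^2) * (1 + (norm \<theta>)^2) * envelope x" for \<theta> x
  proof -
    let ?s = "fst \<theta> + snd \<theta>"
    have "(fluct e c t \<theta> x)^2 \<le> 2 * (grad c t \<theta> x \<bullet> e)^2 + 2 * (lam e * (?s \<bullet> e))^2"
      unfolding fluct_def using sum_squares_bound[of "grad c t \<theta> x \<bullet> e" "- (lam e * (?s \<bullet> e))"]
      by (simp add: power2_diff)
    also have "\<dots> \<le> 2 * (norm (grad c t \<theta> x))^2 + 2 * ((lam e)^2 * (2 * (norm \<theta>)^2))"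
      unfolding power_mult_distrib
      by (intro add_mono mult_left_mono order_trans[OF B_bound_square[OF e] norm_sum_le(1)]
          B_bound_square[OF e]) auto
    also have "\<dots> \<le> 2 * ((4 + 2 * (c * (real t + 1))^2) * (1 + (norm \<theta>)^2) * envelope x)
        + 2 * ((lam e)^2 * (2 * ((1 + (norm \<theta>)^2) * envelope x)))"
    proof -
      have "(norm \<theta>)^2 \<le> (1 + (norm \<theta>)^2) * envelope x"
        using mult_mono[of "(norm \<theta>)^2" "1 + (norm \<theta>)^2" 1 "envelope x"] envelope_ge(1) by simp
      then show ?thesis by (intro add_mono mult_left_mono grad_bound) auto
    qed
    finally show ?thesis by (simp add: algebra_simps)
  qed
  have f2m: "(\<lambda>(\<theta>, x). (fluct e c t \<theta> x)^2) \<in> borel_measurable (borel \<Otimes>\<^sub>M M)"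
    unfolding fluct_def grad_def case_prod_beta by measurable
  show intf: "integrable S (\<lambda>w. \<integral>x. (fluct e c t (proc c v w t) x)^2 \<partial>M)"
    by (rule expectation_split(3)[OF f2m bf proc_moment])
  have "second_moment c v e (Suc t) p q = (\<integral>w. (\<integral>x. (?F (proc c v w t) x)^2 \<partial>M) \<partial>S)"
    unfolding second_moment_def proc.simps
    by (rule expectation_split(2)[OF F2m _ proc_moment]) (use F2 in auto)
  \<comment> \<open>For a fixed state \<open>fluct\<close> has mean zero, so the mixed term of the
    square integrates to zero.\<close>
  also have "(\<lambda>w. \<integral>x. (?F (proc c v w t) x)^2 \<partial>M)
      = (\<lambda>w. (?L (proc c v w t))^2 + ?r^2 * (\<integral>x. (fluct e c t (proc c v w t) x)^2 \<partial>M))"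
  proof
    fix w
    let ?\<theta> = "proc c v w t"
    have "(?F ?\<theta> x)^2 = ((?L ?\<theta>)^2 - 2 * ?L ?\<theta> * ?r * fluct e c t ?\<theta> x) + ?r^2 * (fluct e c t ?\<theta> x)^2" for x
      unfolding F by algebra
    then show "(\<integral>x. (?F ?\<theta> x)^2 \<partial>M) = (?L ?\<theta>)^2 + ?r^2 * (\<integral>x. (fluct e c t ?\<theta> x)^2 \<partial>M)"
      using fm by (simp add: total_mass)
  qed
  also have "(\<integral>w. (?L (proc c v w t))^2 + ?r^2 * (\<integral>x. (fluct e c t (proc c v w t) x)^2 \<partial>M) \<partial>S)
      = second_moment c v e t p' q' + ?r^2 * fluct_level c v e t"
    unfolding second_moment_def fluct_level_def using intf component_square_integrable[OF e] by simp
  finally show "second_moment c v e (Suc t) p q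
      = case_prod (second_moment c v e t) (dual_step (\<beta> * lam e) (\<alpha> * lam e) (p, q))
        + ?r^2 * fluct_level c v e t"
    unfolding d by simp
qed

text \<open>First moments follow the dual recursion without forcing, and the process starts at the
  origin.\<close>

lemma first_moment_zero: "e \<in> B \<Longrightarrow> first_moment c 0 e t p q = 0"
proof (induction t arbitrary: p q)
  case 0
  then show ?case by (simp add: first_moment_def)
qed (simp add: first_moment_Suc split: prod.split)

lemma energy_eq: "energy c v t = (\<Sum>e\<in>B. lam e * second_moment c v e t 1 1)"
  unfolding energy_def second_moment_def
  by (subst Bochner_Integration.integral_sum)
    (use component_square_integrable[of _ 1 c v t 1] in \<open>auto simp: inner_add_left\<close>)

text \<open>The two alternatives are the bias and the variance part. The mixed term vanishes in the
  former because its coefficient contains \<open>c\<close>, in the latter because the state has mean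
  zero.\<close>

lemma fluct_level_le:
  assumes e: "e \<in> B" and cv: "c = 0 \<or> v = 0"
  shows "fluct_level c v e t \<le> \<kappa> * lam e * energy c v t + (c * (real t + 1))^2 * (\<sigma>^2 * lam e)"
proof -
  let ?s = "\<lambda>w. fst (proc c v w t) + snd (proc c v w t)" and ?k = "c * (real t + 1)"
  let ?Q = "\<lambda>w. \<Sum>f\<in>B. lam f * (?s w \<bullet> f)^2"
  have si: "integrable S (\<lambda>w. ?s w \<bullet> f)" if "f \<in> B" for f
    using component_integrable[OF that, of 1 c v t 1] by (simp add: inner_add_left)
  have exp: "?s w \<bullet> cross e = (\<Sum>f\<in>B. (?s w \<bullet> f) * (cross e \<bullet> f))" for w
    by (rule orthonormal_inner[OF B])
  have ci: "integrable S (\<lambda>w. ?s w \<bullet> cross e)"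
    unfolding exp using si by (intro Bochner_Integration.integrable_sum integrable_mult_left)
  have Qi: "integrable S ?Q"
    using component_square_integrable[of _ 1 c v t 1] by (auto simp: inner_add_left)
  have c0: "?k * (\<integral>w. ?s w \<bullet> cross e \<partial>S) = 0"
  proof (cases "c = 0")
    case False
    with cv have v: "v = 0" by simp
    have "(\<integral>w. ?s w \<bullet> cross e \<partial>S) = (\<Sum>f\<in>B. first_moment c v f t 1 1 * (cross e \<bullet> f))"
      unfolding exp first_moment_def using si by (subst Bochner_Integration.integral_sum) (auto simp: inner_add_left)
    then show ?thesis by (simp add: v first_moment_zero)
  qed simp
  have "fluct_level c v e t \<le> (\<integral>w. \<kappa> * lam e * ?Q w - 2 * ?k * (?s w \<bullet> cross e) + ?k^2 * (\<sigma>^2 * lam e) \<partial>S)"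
    unfolding fluct_level_def
    by (rule integral_mono[OF fluct_level_integrable[OF e]])
      (use Qi ci order_trans[OF fluct_moments(4)[OF e] grad_square_le[OF e]] in auto)
  also have "\<dots> = \<kappa> * lam e * (\<integral>w. ?Q w \<partial>S) - 2 * (?k * (\<integral>w. ?s w \<bullet> cross e \<partial>S)) + ?k^2 * (\<sigma>^2 * lam e)"
    using Qi ci by (simp add: P.prob_space)
  finally show ?thesis unfolding c0 energy_def by simp
qed

text \<open>Unrolling along each eigenvector and summing over \<open>B\<close> gives the renewal
  inequality with kernel \<open>g\<close>; the two bounds on the second dual coordinate give the
  minimum.\<close>

lemma energy_bound:
  assumes ab: "0 < \<alpha>" "0 < \<beta>" "2 * \<alpha> \<le> \<beta>" and k: "0 \<le> \<kappa>"
    and small: "\<And>e. e \<in> B \<Longrightarrow> (\<alpha> + 2 * \<beta>) * lam e \<le> 1"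
    and G: "\<kappa> * G \<le> 2 / 3" "G = (\<Sum>e\<in>B. (2 * \<alpha> / \<beta> + (\<alpha> + 2 * \<beta>) * lam e) / 3)"
    and cv: "c = 0 \<or> v = 0"
  shows "energy c v t \<le> 3 * (min (1 / \<alpha>) ((real t + 1) / \<beta>) * (norm v)^2) + 3 * G * (c^2 * \<sigma>^2) * (real t)^2"
proof -
  define d where "d e = dual_iter (\<beta> * lam e) (\<alpha> * lam e)" for e
  define r where "r e j = \<beta> * fst (d e j) + \<alpha> * snd (d e j)" for e j
  \<comment> \<open>One factor \<open>lam e\<close> is the weight in \<open>energy\<close>, the
    other comes from the variance bound. This makes the kernel a sum of the squared forcings
    \<open>(\<beta> * lam e * p + \<alpha> * lam e * q)^2\<close> of the dual recursion.\<close>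
  define g where "g j = (\<Sum>e\<in>B. (lam e)^2 * (r e j)^2)" for j
  let ?m = "\<lambda>t::nat. min (1 / \<alpha>) ((real t + 1) / \<beta>)"
  have pos: "0 < \<alpha> * lam e" "0 < \<beta> * lam e" "\<alpha> * lam e + 2 * (\<beta> * lam e) \<le> 1" if "e \<in> B" for e
    using lam_pos[OF that] small[OF that] ab by (auto simp: algebra_simps)
  have g0: "g j \<ge> 0" for j unfolding g_def by (intro sum_nonneg) auto
  have gG: "(\<Sum>j<J. g j) \<le> G" for J
  proof -
    have "(\<Sum>j<J. g j) = (\<Sum>e\<in>B. \<Sum>j<J. (lam e)^2 * (r e j)^2)"
      unfolding g_def by (rule sum.swap)
    also have "\<dots> \<le> G" unfolding G
    proof (rule sum_mono)
      fix e assume e: "e \<in> B"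
      have "(lam e)^2 * (r e j)^2 = (\<beta> * lam e * fst (d e j) + \<alpha> * lam e * snd (d e j))^2" for j
        unfolding r_def by algebra
      then have "(\<Sum>j<J. (lam e)^2 * (r e j)^2)
          \<le> (2 * (\<alpha> * lam e) / (\<beta> * lam e) + \<alpha> * lam e + 2 * (\<beta> * lam e)) / 3"
        using dual_iter_forcing_sum[OF pos(2,1,3)[OF e]] by (simp add: d_def)
      also have "\<dots> = (2 * \<alpha> / \<beta> + (\<alpha> + 2 * \<beta>) * lam e) / 3"
        using lam_pos[OF e] by (simp add: algebra_simps)
      finally show "(\<Sum>j<J. (lam e)^2 * (r e j)^2) \<le> (2 * \<alpha> / \<beta> + (\<alpha> + 2 * \<beta>) * lam e) / 3" .
    qed
    finally show ?thesis .
  qed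
  have m1: "mono ?m" using ab by (intro monoI min.mono divide_right_mono) auto
  have m2: "0 \<le> ?m t" for t using ab by simp
  have comp: "lam e * second_moment c v e t 1 1 \<le> ?m t * (v \<bullet> e)^2
      + (\<Sum>k<t. (lam e)^2 * (r e (t - Suc k))^2 * (\<kappa> * energy c v k + (real k + 1)^2 * (c^2 * \<sigma>^2)))"
    if e: "e \<in> B" for e t
  proof -
    note p = pos[OF e]
    have b1: "\<beta> * lam e \<le> 1" "\<alpha> * lam e \<le> 1" using p by linarith+
    have "(\<beta> * lam e)^2 \<le> \<beta> * lam e" using p b1 by (simp add: power2_eq_square mult_left_le)
    moreover have "\<alpha> * lam e \<le> \<beta> * lam e" using ab lam_pos[OF e] by (intro mult_right_mono) auto
    ultimately have "\<alpha> * lam e + (\<beta> * lam e)^2 \<le> 2 * (\<beta> * lam e)" by linarith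
    note q = dual_iter_snd_bounds[OF p(2) b1(1) p(1) b1(2) this, of t]
    have "lam e * (snd (d e t))^2 \<le> 1 / \<alpha>" "lam e * (snd (d e t))^2 \<le> (real t + 1) / \<beta>"
      using q ab by (simp_all add: d_def field_simps)
    then have "lam e * (snd (d e t))^2 \<le> ?m t" by simp
    then have h: "lam e * (snd (d e t))^2 * (v \<bullet> e)^2 \<le> ?m t * (v \<bullet> e)^2" by (rule mult_right_mono) simp
    have "second_moment c v e t 1 1 = case_prod (second_moment c v e 0) (d e t) + (\<Sum>k<t. (r e (t - Suc k))^2 * fluct_level c v e k)"
      unfolding d_def r_def by (rule dual_unroll) (rule second_moment_Suc[OF e])
    \<comment> \<open>The first component starts at 0, so the initial displacement is seen only by
      the second dual coordinate.\<close>
    also have "case_prod (second_moment c v e 0) (d e t) = (snd (d e t))^2 * (v \<bullet> e)^2"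
      by (simp add: second_moment_def case_prod_beta P.prob_space power_mult_distrib)
    finally have "lam e * second_moment c v e t 1 1 = lam e * (snd (d e t))^2 * (v \<bullet> e)^2
        + (\<Sum>k<t. lam e * (r e (t - Suc k))^2 * fluct_level c v e k)"
      by (simp add: distrib_left sum_distrib_left mult.assoc)
    also have "\<dots> \<le> ?m t * (v \<bullet> e)^2 + (\<Sum>k<t. lam e * (r e (t - Suc k))^2
        * (\<kappa> * lam e * energy c v k + (c * (real k + 1))^2 * (\<sigma>^2 * lam e)))"
      using lam_pos[OF e] by (intro add_mono h sum_mono mult_left_mono fluct_level_le[OF e cv]) auto
    also have "(\<Sum>k<t. lam e * (r e (t - Suc k))^2
        * (\<kappa> * lam e * energy c v k + (c * (real k + 1))^2 * (\<sigma>^2 * lam e)))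
      = (\<Sum>k<t. (lam e)^2 * (r e (t - Suc k))^2 * (\<kappa> * energy c v k + (real k + 1)^2 * (c^2 * \<sigma>^2)))"
      by (rule sum.cong) (simp, algebra)
    finally show ?thesis .
  qed
  have rec: "energy c v t \<le> ?m t * (norm v)^2
      + (\<Sum>k<t. g (t - Suc k) * (\<kappa> * energy c v k + (real k + 1)^2 * (c^2 * \<sigma>^2)))" for t
  proof -
    have "energy c v t \<le> (\<Sum>e\<in>B. ?m t * (v \<bullet> e)^2
        + (\<Sum>k<t. (lam e)^2 * (r e (t - Suc k))^2 * (\<kappa> * energy c v k + (real k + 1)^2 * (c^2 * \<sigma>^2))))"
      unfolding energy_eq[of c v t] by (intro sum_mono comp)
    also have "\<dots> = ?m t * (\<Sum>e\<in>B. (v \<bullet> e)^2)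
        + (\<Sum>k<t. g (t - Suc k) * (\<kappa> * energy c v k + (real k + 1)^2 * (c^2 * \<sigma>^2)))"
      unfolding g_def sum.distrib sum_distrib_left[symmetric] sum_distrib_right
      by (subst sum.swap) simp
    also have "(\<Sum>e\<in>B. (v \<bullet> e)^2) = (norm v)^2"
      unfolding power2_norm_eq_inner by (simp only: orthonormal_inner[OF B, of v v] power2_eq_square)
    finally show ?thesis .
  qed
  show ?thesis
    by (rule renewal_bound[where F = "energy c v" and m = ?m and A = "(norm v)^2" and g = g and \<kappa> = \<kappa>
        and s = "c^2 * \<sigma>^2" and G = G]) (use rec g0 gG k G m1 m2 in auto)
qed

section \<open>Bias and variance parts combined\<close>

lemma proc_add: "proc 1 v w t = proc 0 v w t + proc 1 0 w t"
  by (induction t) (simp_all add: step_def grad_def prod_eq_iff algebra_simps inner_add_right)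

lemma energy_integrable:
  "integrable S (\<lambda>w. \<Sum>f\<in>B. lam f * ((fst (proc c v w t) + snd (proc c v w t)) \<bullet> f)^2)"
  using component_square_integrable[of _ 1 c v t 1] by (auto simp: inner_add_left)

lemma energy_bias_variance: "energy 1 v t \<le> 2 * energy 0 v t + 2 * energy 1 0 t"
proof -
  have "energy 1 v t \<le> (\<integral>w. 2 * (\<Sum>f\<in>B. lam f * ((fst (proc 0 v w t) + snd (proc 0 v w t)) \<bullet> f)^2)
      + 2 * (\<Sum>f\<in>B. lam f * ((fst (proc 1 0 w t) + snd (proc 1 0 w t)) \<bullet> f)^2) \<partial>S)"
    unfolding energy_def
  proof (rule integral_mono)
    fix w
    have "lam f * ((fst (proc 1 v w t) + snd (proc 1 v w t)) \<bullet> f)^2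
        \<le> 2 * (lam f * ((fst (proc 0 v w t) + snd (proc 0 v w t)) \<bullet> f)^2)
          + 2 * (lam f * ((fst (proc 1 0 w t) + snd (proc 1 0 w t)) \<bullet> f)^2)" if f: "f \<in> B" for f
    proof -
      let ?x = "(fst (proc 0 v w t) + snd (proc 0 v w t)) \<bullet> f"
        and ?y = "(fst (proc 1 0 w t) + snd (proc 1 0 w t)) \<bullet> f"
      have "(fst (proc 1 v w t) + snd (proc 1 v w t)) \<bullet> f = ?x + ?y"
        by (simp add: proc_add[of v w t] inner_add_left)
      moreover have "(?x + ?y)^2 \<le> 2 * ?x^2 + 2 * ?y^2"
        using sum_squares_bound[of ?x ?y] by (simp add: power2_sum)
      then have "lam f * (?x + ?y)^2 \<le> lam f * (2 * ?x^2 + 2 * ?y^2)"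
        using lam_pos[OF f] by (intro mult_left_mono) auto
      ultimately show ?thesis by (simp only:) (simp add: algebra_simps)
    qed
    then show "(\<Sum>f\<in>B. lam f * ((fst (proc 1 v w t) + snd (proc 1 v w t)) \<bullet> f)^2)
        \<le> 2 * (\<Sum>f\<in>B. lam f * ((fst (proc 0 v w t) + snd (proc 0 v w t)) \<bullet> f)^2)
          + 2 * (\<Sum>f\<in>B. lam f * ((fst (proc 1 0 w t) + snd (proc 1 0 w t)) \<bullet> f)^2)"
      unfolding sum_distrib_left sum.distrib[symmetric] by (rule sum_mono)
  qed (intro Bochner_Integration.integrable_add integrable_mult_right energy_integrable)+
  also have "\<dots> = 2 * energy 0 v t + 2 * energy 1 0 t"
    unfolding energy_def using energy_integrable by simp
  finally show ?thesis .
qed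

text \<open>The factor 2 lost in splitting bias from variance cancels the 2 in the denominator. The
  noise term grows like \<open>(real t)^2\<close> and is thus tamed by
  \<open>(real t + 1)^2\<close>.\<close>

lemma last_iterate_bound:
  assumes ab: "0 < \<alpha>" "0 < \<beta>" "2 * \<alpha> \<le> \<beta>" and k: "0 \<le> \<kappa>"
    and small: "\<And>e. e \<in> B \<Longrightarrow> (\<alpha> + 2 * \<beta>) * lam e \<le> 1"
    and G: "\<kappa> * G \<le> 2 / 3" "G = (\<Sum>e\<in>B. (2 * \<alpha> / \<beta> + (\<alpha> + 2 * \<beta>) * lam e) / 3)"
    and t: "1 \<le> t"
  shows "energy 1 v t / (2 * (real t + 1)^2)
    \<le> min (3 / (\<alpha> * real t ^ 2)) (24 / (\<beta> * real t)) * (norm v)^2 + 3 * G * \<sigma>^2"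
proof -
  let ?m = "min (1 / \<alpha>) ((real t + 1) / \<beta>)" and ?T = "(real t + 1)^2"
  have G0: "0 \<le> G" unfolding G(2) using ab lam_pos
    by (intro sum_nonneg divide_nonneg_pos add_nonneg_nonneg mult_nonneg_nonneg) (auto intro: less_imp_le)
  have "energy 1 v t \<le> 2 * (3 * (?m * (norm v)^2)) + 2 * (3 * G * \<sigma>^2 * (real t)^2)"
    using energy_bias_variance[of v t] energy_bound[OF ab k small G, of 0 v t]
      energy_bound[OF ab k small G, of 1 0 t] by simp
  then have "energy 1 v t / (2 * ?T) \<le> (2 * (3 * (?m * (norm v)^2)) + 2 * (3 * G * \<sigma>^2 * (real t)^2)) / (2 * ?T)"
    by (intro divide_right_mono) auto
  also have "\<dots> = 3 * ?m / ?T * (norm v)^2 + 3 * G * \<sigma>^2 * ((real t)^2 / ?T)"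
    by (simp add: add_divide_distrib mult_ac)
  also have "\<dots> \<le> min (3 / (\<alpha> * real t ^ 2)) (24 / (\<beta> * real t)) * (norm v)^2 + 3 * G * \<sigma>^2 * 1"
  proof (intro add_mono mult_right_mono mult_left_mono min.boundedI)
    have sq: "(real t)^2 \<le> ?T" by (intro power_mono) auto
    then show "(real t)^2 / ?T \<le> 1" by (simp add: divide_le_eq_1)
    have "3 * ?m / ?T \<le> 3 * (1 / \<alpha>) / ?T" by (intro divide_right_mono mult_left_mono) auto
    also have "\<dots> = 3 / (\<alpha> * ?T)" by simp
    also have "\<dots> \<le> 3 / (\<alpha> * real t ^ 2)"
      using ab t sq by (intro divide_left_mono mult_left_mono) (auto simp: zero_less_mult_iff)
    finally show "3 * ?m / ?T \<le> 3 / (\<alpha> * real t ^ 2)" .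
    \<comment> \<open>In the second branch of the minimum one factor \<open>real t + 1\<close>
      cancels, which turns the rate from quadratic to linear.\<close>
    have "3 * ?m / ?T \<le> 3 * ((real t + 1) / \<beta>) / ?T" by (intro divide_right_mono mult_left_mono) auto
    also have "\<dots> = 3 / (\<beta> * (real t + 1))"
    proof -
      have "3 * (r / \<beta>) / r^2 = 3 / (\<beta> * r)" for r :: real by (simp add: power2_eq_square)
      then show ?thesis .
    qed
    also have "\<dots> \<le> 24 / (\<beta> * real t)"
      using ab t by (intro frac_le mult_left_mono) auto
    finally show "3 * ?m / ?T \<le> 24 / (\<beta> * real t)" .
  qed (use G0 in auto)
  finally show ?thesis by simp
qed

end

section \<open>Rank-one matrices and the Loewner order\<close>

lemma outer_inner: "v \<bullet> (outer x *v w) = (x \<bullet> v) * (x \<bullet> w)"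
  by (simp add: outer_def inner_vec_def matrix_vector_mult_def sum_distrib_left sum_distrib_right
      sum_product mult_ac) (subst sum.swap, simp add: mult_ac)

lemma norm_outer: "norm (outer x) = (norm x)^2"
proof -
  have "outer x \<bullet> outer x = (x \<bullet> x)^2"
    by (simp add: outer_def inner_vec_def power2_eq_square sum_product mult_ac)
  then show ?thesis by (simp add: norm_eq_sqrt_inner real_sqrt_power)
qed

lemma trace_outer_mult: "trace (outer x ** A) = x \<bullet> (A *v x)"
  by (simp add: trace_def outer_def matrix_matrix_mult_def inner_vec_def matrix_vector_mult_def
      sum_distrib_left mult_ac) (subst sum.swap, simp add: mult_ac)

lemma trace_outer: "trace (outer x) = x \<bullet> x"
  by (simp add: trace_def outer_def inner_vec_def)

lemma transpose_outer: "transpose (outer x) = outer x"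
  by (simp add: transpose_def outer_def vec_eq_iff mult.commute)

lemma psd_outer: "psd (outer x)"
  by (simp add: psd_def transpose_outer outer_inner)

text \<open>Lets a bilinear form pass under the Bochner integral, so that the matrix assumptions
  become scalar ones.\<close>

lemma linear_sandwich: "bounded_linear (\<lambda>A :: real^'n^'n. v \<bullet> (A *v w))"
  by (intro linear_conv_bounded_linear[THEN iffD1] linearI)
    (simp_all add: matrix_vector_mult_add_rdistrib inner_add_right scaleR_matrix_vector_assoc[symmetric])

lemma bounded_linear_trace: "bounded_linear (trace :: real^'n^'n \<Rightarrow> real)"
  by (intro linear_conv_bounded_linear[THEN iffD1] linearI)
    (simp_all add: trace_def sum.distrib sum_distrib_left)

lemma outer_measurable [measurable]: "(outer :: real^'n \<Rightarrow> _) \<in> borel_measurable borel"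
  unfolding outer_def by (intro borel_measurable_continuous_onI continuous_intros)

lemma loewner_leD: "loewner_le P Q \<Longrightarrow> v \<bullet> (P *v v) \<le> v \<bullet> (Q *v v)"
  by (simp add: loewner_le_def psd_def matrix_vector_mult_diff_rdistrib inner_diff_right)

text \<open>For small \<open>c\<close> the linear term dominates. The proof evaluates at the
  minimiser of \<open>c * A + c^2 * E\<close>, where \<open>E \<ge> D\<close> is positive whatever
  the sign of \<open>D\<close>.\<close>

lemma quadratic_nonneg_imp_linear_zero:
  fixes A D :: real
  assumes "\<And>c. 0 \<le> c * A + c^2 * D"
  shows "A = 0"
proof -
  define E where "E = \<bar>D\<bar> + 1"
  define c where "c = - A / (2 * E)"
  have E: "0 < E" "D \<le> E" by (auto simp: E_def)
  have "0 \<le> c * A + c^2 * D" by (rule assms)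
  also have "\<dots> \<le> c * A + c^2 * E" using E by (intro add_left_mono mult_left_mono) auto
  also have "\<dots> = - (A^2 / (4 * E))" using E by (simp add: c_def field_simps power2_eq_square)
  finally show ?thesis using E by (simp add: divide_le_0_iff)
qed

section \<open>The last iterate\<close>

theorem theorem3:
  fixes rho :: "((real^'n) \<times> real) measure"
    and xs x0 :: "real^'n"
    and \<sigma> \<kappa> \<alpha> \<beta> :: real
    and t :: nat
  assumes prob: "prob_space rho"
    and sets_rho: "sets rho = sets borel"
    and mom_a: "integrable rho (\<lambda>p. (norm (fst p))^2)"
    and mom_b: "integrable rho (\<lambda>p. (snd p)^2)"
    and H_inv: "invertible (Hmat rho)"
    and xs_min: "\<forall>x. risk rho xs \<le> risk rho x"
    and noise_int: "integrable rho (\<lambda>p. (snd p - xs \<bullet> fst p)^2 *\<^sub>R outer (fst p))"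
    and noise: "loewner_le (\<integral>p. (snd p - xs \<bullet> fst p)^2 *\<^sub>R outer (fst p) \<partial>rho)
                           (\<sigma>^2 *\<^sub>R Hmat rho)"
    and kurt_int: "\<forall>M. psd M \<longrightarrow>
                     integrable rho (\<lambda>p. (fst p \<bullet> (M *v fst p)) *\<^sub>R outer (fst p))"
    and kurt: "\<forall>M. psd M \<longrightarrow>
                 loewner_le (\<integral>p. (fst p \<bullet> (M *v fst p)) *\<^sub>R outer (fst p) \<partial>rho)
                            ((\<kappa> * trace (M ** Hmat rho)) *\<^sub>R Hmat rho)"
    and \<alpha>_pos: "\<alpha> > 0" and \<beta>_pos: "\<beta> > 0"
    and step1: "\<kappa> * (\<alpha> + 2 * \<beta>) * trace (Hmat rho) \<le> 1"
    and step2: "\<alpha> \<le> \<beta> / (2 * \<kappa> * real CARD('n))"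
    and t_pos: "t \<ge> 1"
  shows "(\<integral>\<^sup>+ w. ennreal (risk rho (acsgd_x \<alpha> \<beta> x0 w t) - risk rho xs)
            \<partial>(\<Pi>\<^sub>M i\<in>(UNIV::nat set). rho))
         \<le> ennreal (min (3 / (\<alpha> * real t ^ 2)) (24 / (\<beta> * real t)) * (norm (x0 - xs))^2
                    + 2 * ((\<alpha> + 2 * \<beta>) * trace (Hmat rho) + 2 * \<alpha> * real CARD('n) / \<beta>) * \<sigma>^2)"
proof -
  interpret prob_space rho by fact
  have rho_meas: "measurable rho N = measurable borel N" for N :: "'z measure"
    by (intro measurable_cong_sets sets_rho refl)
  have [measurable]: "fst \<in> borel_measurable rho" "snd \<in> borel_measurable rho"
    unfolding rho_meas by (intro borel_measurable_continuous_onI continuous_intros)+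
  define H where "H = Hmat rho"
  define \<eta> where "\<eta> p = snd p - xs \<bullet> fst p" for p :: "(real^'n) \<times> real"
  have eta_meas [measurable]: "\<eta> \<in> borel_measurable rho" unfolding \<eta>_def by measurable

  \<comment> \<open>The quadratic form of \<open>H\<close> and its eigenbasis\<close>
  have outer_int: "integrable rho (\<lambda>p. outer (fst p))"
    by (rule Bochner_Integration.integrable_bound[OF mom_a]) (measurable, simp add: norm_outer)
  have sandwich: "integrable rho (\<lambda>p. u \<bullet> (F p *v w))" "(\<integral>p. u \<bullet> (F p *v w) \<partial>rho) = u \<bullet> ((\<integral>p. F p \<partial>rho) *v w)"
    if "integrable rho F" for F :: "_ \<Rightarrow> real^'n^'n" and u w
    using integrable_bounded_linear[OF linear_sandwich that] integral_bounded_linear[OF linear_sandwich that]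
    by auto
  have H_quad: "integrable rho (\<lambda>p. (fst p \<bullet> u) * (fst p \<bullet> w))"
    "(\<integral>p. (fst p \<bullet> u) * (fst p \<bullet> w) \<partial>rho) = u \<bullet> (H *v w)" for u w
    using sandwich[OF outer_int, of u w] by (simp_all add: outer_inner H_def Hmat_def)
  have H_sym: "(H *v u) \<bullet> w = u \<bullet> (H *v w)" for u w
  proof -
    have "w \<bullet> (H *v u) = u \<bullet> (H *v w)"
      unfolding H_quad(2)[symmetric] by (simp add: mult.commute)
    then show ?thesis by (simp add: inner_commute)
  qed
  obtain B where B: "pairwise orthogonal B" "\<And>e. e \<in> B \<Longrightarrow> norm e = 1" "span B = UNIV"
    and He: "\<And>e. e \<in> B \<Longrightarrow> H *v e = (e \<bullet> (H *v e)) *\<^sub>R e"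
    using symmetric_orthonormal_eigenbasis[of "(*v) H"] H_sym by (metis matrix_vector_mul_linear)
  define lam where "lam e = e \<bullet> (H *v e)" for e
  note fin = orthonormal_finite[OF B]
  have card_B: "card B = CARD('n)" using orthonormal_card[OF B] by simp
  have sHe: "s \<bullet> (H *v e) = lam e * (s \<bullet> e)" if "e \<in> B" for s e
    by (subst He[OF that]) (simp add: lam_def)
  have sHs: "s \<bullet> (H *v s) = (\<Sum>f\<in>B. lam f * (s \<bullet> f)^2)" for s
  proof -
    have "s \<bullet> (H *v s) = (\<Sum>f\<in>B. (s \<bullet> f) * ((H *v s) \<bullet> f))" by (rule orthonormal_inner[OF B])
    also have "\<dots> = (\<Sum>f\<in>B. lam f * (s \<bullet> f)^2)"
      by (rule sum.cong) (auto simp: H_sym sHe power2_eq_square)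
    finally show ?thesis .
  qed
  have trace_H: "trace H = (\<Sum>e\<in>B. lam e)"
  proof -
    have "trace H = (\<integral>p. trace (outer (fst p)) \<partial>rho)"
      unfolding H_def Hmat_def by (rule integral_bounded_linear[OF bounded_linear_trace outer_int, symmetric])
    also have "\<dots> = (\<integral>p. (\<Sum>e\<in>B. (fst p \<bullet> e) * (fst p \<bullet> e)) \<partial>rho)"
    proof -
      have "trace (outer x) = (\<Sum>e\<in>B. (x \<bullet> e) * (x \<bullet> e))" for x :: "real^'n"
        by (simp only: trace_outer orthonormal_inner[OF B, symmetric])
      then show ?thesis by simp
    qed
    also have "\<dots> = (\<Sum>e\<in>B. lam e)"
      using H_quad by (simp add: lam_def)
    finally show ?thesis .
  qed

  \<comment> \<open>Expansion of the risk around its minimiser\<close>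
  have eta_int: "integrable rho (\<lambda>p. (\<eta> p)^2)"
  proof (rule Bochner_Integration.integrable_bound)
    show "integrable rho (\<lambda>p. 2 * (snd p)^2 + 2 * ((fst p \<bullet> xs) * (fst p \<bullet> xs)))"
      using mom_b H_quad(1) by (intro Bochner_Integration.integrable_add integrable_mult_right)
    have "(\<eta> p)^2 \<le> 2 * (snd p)^2 + 2 * ((fst p \<bullet> xs) * (fst p \<bullet> xs))" for p
      using sum_squares_bound[of "snd p" "- (xs \<bullet> fst p)"]
      by (simp add: \<eta>_def power2_eq_square inner_commute[of "fst p"] algebra_simps)
    then show "AE p in rho. norm ((\<eta> p)^2) \<le> norm (2 * (snd p)^2 + 2 * ((fst p \<bullet> xs) * (fst p \<bullet> xs)))"
      by (intro always_eventually allI) (simp add: abs_of_nonneg)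
  qed measurable
  have eta_a_int: "integrable rho (\<lambda>p. \<eta> p * (fst p \<bullet> y))" for y
  proof (rule Bochner_Integration.integrable_bound)
    show "integrable rho (\<lambda>p. (\<eta> p)^2 + (fst p \<bullet> y) * (fst p \<bullet> y))"
      using eta_int H_quad(1) by (intro Bochner_Integration.integrable_add)
    have "\<bar>\<eta> p * (fst p \<bullet> y)\<bar> \<le> (\<eta> p)^2 + (fst p \<bullet> y) * (fst p \<bullet> y)" for p
    proof -
      have "2 * \<bar>\<eta> p\<bar> * \<bar>fst p \<bullet> y\<bar> \<le> \<bar>\<eta> p\<bar>^2 + \<bar>fst p \<bullet> y\<bar>^2" by (rule sum_squares_bound)
      moreover have "0 \<le> \<bar>\<eta> p\<bar> * \<bar>fst p \<bullet> y\<bar>" by simp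
      ultimately show ?thesis by (simp only: abs_mult power2_abs power2_eq_square) linarith
    qed
    then show "AE p in rho. norm (\<eta> p * (fst p \<bullet> y)) \<le> norm ((\<eta> p)^2 + (fst p \<bullet> y) * (fst p \<bullet> y))"
      by (intro always_eventually allI) (metis abs_ge_self order_trans real_norm_def)
  qed measurable
  have risk_exp: "risk rho (xs + y) = risk rho xs - (\<integral>p. \<eta> p * (fst p \<bullet> y) \<partial>rho) + (y \<bullet> (H *v y)) / 2" for y
  proof -
    have "risk rho (xs + y) = (1/2) * (\<integral>p. ((\<eta> p)^2 - 2 * (\<eta> p * (fst p \<bullet> y))) + (fst p \<bullet> y) * (fst p \<bullet> y) \<partial>rho)"
      unfolding risk_def \<eta>_def
      by (intro arg_cong2[where f = "(*)"] Bochner_Integration.integral_cong refl)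
        (simp add: inner_add_left power2_eq_square algebra_simps inner_commute)
    also have "\<dots> = (1/2) * ((\<integral>p. (\<eta> p)^2 \<partial>rho) - 2 * (\<integral>p. \<eta> p * (fst p \<bullet> y) \<partial>rho) + y \<bullet> (H *v y))"
      using eta_int eta_a_int[of y] H_quad[of y y] by simp
    also have "(\<integral>p. (\<eta> p)^2 \<partial>rho) = 2 * risk rho xs"
      unfolding risk_def \<eta>_def by (simp add: power2_commute)
    finally show ?thesis by (simp add: field_simps)
  qed
  \<comment> \<open>The normal equations: along each line through the minimiser the linear term of
    the risk must vanish.\<close>
  have eta_mean: "(\<integral>p. \<eta> p * (fst p \<bullet> y) \<partial>rho) = 0" for y
  proof -
    have "- (\<integral>p. \<eta> p * (fst p \<bullet> y) \<partial>rho) = 0"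
    proof (rule quadratic_nonneg_imp_linear_zero)
      fix c :: real
      have "risk rho xs \<le> risk rho (xs + c *\<^sub>R y)" using xs_min by blast
      also have "\<dots> = risk rho xs - (\<integral>p. \<eta> p * (fst p \<bullet> (c *\<^sub>R y)) \<partial>rho) + ((c *\<^sub>R y) \<bullet> (H *v (c *\<^sub>R y))) / 2"
        by (rule risk_exp)
      also have "(\<lambda>p. \<eta> p * (fst p \<bullet> (c *\<^sub>R y))) = (\<lambda>p. c * (\<eta> p * (fst p \<bullet> y)))"
        by (simp add: fun_eq_iff)
      also have "(c *\<^sub>R y) \<bullet> (H *v (c *\<^sub>R y)) = c^2 * (y \<bullet> (H *v y))"
        by (simp add: matrix_vector_mult_scaleR power2_eq_square)
      finally show "0 \<le> c * - (\<integral>p. \<eta> p * (fst p \<bullet> y) \<partial>rho) + c^2 * ((y \<bullet> (H *v y)) / 2)"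
        by simp
    qed
    then show ?thesis by simp
  qed
  have excess: "risk rho x - risk rho xs = (\<Sum>f\<in>B. lam f * ((x - xs) \<bullet> f)^2) / 2" for x
    using risk_exp[of "x - xs"] eta_mean by (simp add: sHs)

  \<comment> \<open>The moment assumptions along eigenvectors\<close>
  have psd_I: "psd (mat 1 :: real^'n^'n)" by (simp add: psd_def)
  \<comment> \<open>Taking the identity for the positive semidefinite matrix in
    \<open>kurt_int\<close> gives the fourth moment.\<close>
  have a4: "integrable rho (\<lambda>p. norm (fst p) ^ 4)"
    using integrable_norm[OF kurt_int[rule_format, OF psd_I]]
    by (simp add: norm_outer dot_square_norm power4_eq_xxxx power2_eq_square mult.assoc)
  have noise2: "integrable rho (\<lambda>p. (\<eta> p)^2 * (norm (fst p))^2)"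
    using integrable_norm[OF noise_int] by (simp add: norm_outer \<eta>_def)
  \<comment> \<open>Assumption (ii) for the rank-one matrix \<open>outer e\<close>, whose trace
    against \<open>H\<close> is \<open>lam e\<close>, tested on the vector \<open>s\<close>.\<close>
  have kurtosis: "(\<integral>p. (fst p \<bullet> s)^2 * (fst p \<bullet> e)^2 \<partial>rho) \<le> \<kappa> * lam e * (\<Sum>f\<in>B. lam f * (s \<bullet> f)^2)" for e s
  proof -
    let ?F = "\<lambda>p. (fst p \<bullet> (outer e *v fst p)) *\<^sub>R outer (fst p) :: real^'n^'n"
    have "(\<integral>p. (fst p \<bullet> s)^2 * (fst p \<bullet> e)^2 \<partial>rho) = (\<integral>p. s \<bullet> (?F p *v s) \<partial>rho)"
      by (intro Bochner_Integration.integral_cong refl)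
        (simp add: scaleR_matrix_vector_assoc[symmetric] outer_inner power2_eq_square inner_commute)
    also have "\<dots> = s \<bullet> ((\<integral>p. ?F p \<partial>rho) *v s)"
      by (rule sandwich(2)) (use kurt_int psd_outer in blast)
    also have "\<dots> \<le> s \<bullet> (((\<kappa> * trace (outer e ** Hmat rho)) *\<^sub>R Hmat rho) *v s)"
      by (rule loewner_leD) (use kurt psd_outer in blast)
    also have "\<dots> = \<kappa> * lam e * (s \<bullet> (H *v s))"
      by (simp add: scaleR_matrix_vector_assoc[symmetric] trace_outer_mult lam_def H_def)
    finally show ?thesis by (simp add: sHs)
  qed
  have noise_e: "(\<integral>p. (\<eta> p)^2 * (fst p \<bullet> e)^2 \<partial>rho) \<le> \<sigma>^2 * lam e" for e
  proof -
    let ?F = "\<lambda>p. (snd p - xs \<bullet> fst p)^2 *\<^sub>R outer (fst p) :: real^'n^'n"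
    have "(\<integral>p. (\<eta> p)^2 * (fst p \<bullet> e)^2 \<partial>rho) = (\<integral>p. e \<bullet> (?F p *v e) \<partial>rho)"
      by (intro Bochner_Integration.integral_cong refl)
        (simp add: scaleR_matrix_vector_assoc[symmetric] outer_inner power2_eq_square \<eta>_def)
    also have "\<dots> = e \<bullet> ((\<integral>p. ?F p \<partial>rho) *v e)" by (rule sandwich(2)[OF noise_int])
    also have "\<dots> \<le> e \<bullet> ((\<sigma>^2 *\<^sub>R Hmat rho) *v e)" by (rule loewner_leD[OF noise])
    also have "\<dots> = \<sigma>^2 * lam e" by (simp add: scaleR_matrix_vector_assoc[symmetric] lam_def H_def)
    finally show ?thesis .
  qed
  have lam_pos: "0 < lam e" if e: "e \<in> B" for e
  proof -
    have "0 \<le> lam e" unfolding lam_def H_quad(2)[symmetric] by simp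
    moreover have "lam e \<noteq> 0"
    proof
      assume "lam e = 0"
      then have "H *v e = 0" using He[OF e] by (simp add: lam_def)
      then have "e = 0" using H_inv unfolding H_def
        by (metis invertible_def matrix_left_invertible_ker)
      then show False using B(2)[OF e] by simp
    qed
    ultimately show ?thesis by simp
  qed

  \<comment> \<open>Consequences of the step size conditions\<close>
  obtain e0 where e0: "e0 \<in> B" using card_B by (metis card_gt_0_iff ex_in_conv zero_less_card_finite)
  \<comment> \<open>The variance of \<open>(fst p \<bullet> e0)^2\<close> is non-negative, so its
    second moment is at least \<open>(lam e0)^2\<close>; \<open>kurtosis\<close> with both vectors
    equal to \<open>e0\<close> bounds it by \<open>\<kappa> * (lam e0)^2\<close>.\<close>
  have \<kappa>: "1 \<le> \<kappa>"
  proof -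
    let ?X = "\<lambda>p. (fst p \<bullet> e0)^2" and ?l = "lam e0"
    have X: "integrable rho ?X" "(\<integral>p. ?X p \<partial>rho) = ?l"
      using H_quad[of e0 e0] by (simp_all add: power2_eq_square lam_def)
    have X2: "integrable rho (\<lambda>p. (?X p)^2)"
    proof (rule Bochner_Integration.integrable_bound[OF a4])
      have "norm ((?X p)^2) \<le> norm (norm (fst p) ^ 4)" for p
      proof -
        have "\<bar>fst p \<bullet> e0\<bar> \<le> norm (fst p)" using Cauchy_Schwarz_ineq2[of "fst p" e0] B(2)[OF e0] by simp
        then have "\<bar>fst p \<bullet> e0\<bar> ^ 4 \<le> norm (fst p) ^ 4" by (intro power_mono) auto
        then show ?thesis by simp
      qed
      then show "AE p in rho. norm ((?X p)^2) \<le> norm (norm (fst p) ^ 4)"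
        by (intro always_eventually allI)
    qed measurable
    have "0 \<le> (\<integral>p. (?X p - ?l)^2 \<partial>rho)" by simp
    also have "(\<integral>p. (?X p - ?l)^2 \<partial>rho) = (\<integral>p. (?X p)^2 - 2 * ?l * ?X p + ?l^2 \<partial>rho)"
      by (intro Bochner_Integration.integral_cong refl) (simp add: power2_diff mult_ac)
    also have "\<dots> = (\<integral>p. (?X p)^2 \<partial>rho) - 2 * ?l * ?l + ?l^2"
      using X X2 by (simp add: prob_space)
    finally have "?l^2 \<le> (\<integral>p. (?X p)^2 \<partial>rho)" by (simp add: power2_eq_square)
    also have "\<dots> \<le> \<kappa> * ?l * ?l"
      using kurtosis[of e0 e0] unfolding sHs[symmetric]
      by (simp add: power2_eq_square flip: lam_def)
    finally have "1 * ?l^2 \<le> \<kappa> * ?l^2" by (simp add: power2_eq_square mult.assoc)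
    then show ?thesis using lam_pos[OF e0] by (simp only: mult_le_cancel_right_pos zero_less_power)
  qed
  define d where "d = real CARD('n)"
  have d: "1 \<le> d" by (simp add: d_def Suc_leI)
  have step2': "\<kappa> * (2 * \<alpha> * d / \<beta>) \<le> 1"
    using step2 \<kappa> d \<beta>_pos by (simp add: d_def[symmetric] field_simps)
  have ab: "2 * \<alpha> \<le> \<beta>"
  proof -
    have "1 * 1 \<le> \<kappa> * d" using \<kappa> d by (intro mult_mono) auto
    then have "2 * \<alpha> * 1 \<le> 2 * \<alpha> * (\<kappa> * d)" using \<alpha>_pos by (intro mult_left_mono) auto
    also have "\<dots> \<le> \<beta>" using step2' \<beta>_pos by (simp add: field_simps)
    finally show ?thesis by simp
  qed
  define G where "G = (\<Sum>e\<in>B. (2 * \<alpha> / \<beta> + (\<alpha> + 2 * \<beta>) * lam e) / 3)"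
  \<comment> \<open>\<open>3 * G\<close> is the constant in front of the noise level; the two step
    size conditions bound its summands times \<kappa> by 1 each.\<close>
  have G: "3 * G = 2 * \<alpha> * d / \<beta> + (\<alpha> + 2 * \<beta>) * trace H"
    unfolding G_def trace_H sum_divide_distrib[symmetric] sum.distrib sum_distrib_left[symmetric]
    by (simp add: card_B d_def)
  have step1': "\<kappa> * ((\<alpha> + 2 * \<beta>) * trace H) \<le> 1"
    using step1 by (simp add: H_def mult.assoc)
  have "\<kappa> * (3 * G) = \<kappa> * (2 * \<alpha> * d / \<beta>) + \<kappa> * ((\<alpha> + 2 * \<beta>) * trace H)"
    unfolding G by (rule distrib_left)
  with step1' step2' have "\<kappa> * (3 * G) \<le> 2" by linarith
  then have \<kappa>G: "\<kappa> * G \<le> 2 / 3" by simp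
  have small: "(\<alpha> + 2 * \<beta>) * lam e \<le> 1" if e: "e \<in> B" for e
  proof -
    have "lam e \<le> trace H" unfolding trace_H using fin e lam_pos by (intro member_le_sum) (auto intro: less_imp_le)
    then have le: "(\<alpha> + 2 * \<beta>) * lam e \<le> (\<alpha> + 2 * \<beta>) * trace H"
      using \<alpha>_pos \<beta>_pos by (intro mult_left_mono) auto
    have "0 \<le> (\<alpha> + 2 * \<beta>) * lam e" using \<alpha>_pos \<beta>_pos lam_pos[OF e] by simp
    with le have "1 * ((\<alpha> + 2 * \<beta>) * trace H) \<le> \<kappa> * ((\<alpha> + 2 * \<beta>) * trace H)"
      using \<kappa> by (intro mult_right_mono) auto
    with le step1' show ?thesis by linarith
  qed

  \<comment> \<open>AcSGD as an instance of the abstract process\<close>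
  interpret A: accelerated_lsq rho fst \<eta> B lam \<alpha> \<beta> \<kappa> \<sigma>
  proof unfold_locales
    show "(\<integral>p. (fst p \<bullet> s) * (fst p \<bullet> e) \<partial>rho) = lam e * (s \<bullet> e)" if "e \<in> B" for e s
      by (simp add: H_quad(2) sHe[OF that])
  qed (use a4 noise2 B eta_mean kurtosis noise_e lam_pos in auto)
  \<comment> \<open>The first component is written through \<open>x\<close> and \<open>z\<close>; by
    the averaging rule for \<open>x\<close> it equals \<open>n\<close> times the error of
    \<open>y\<close>. At \<open>n = 0\<close> it is zero because \<open>x\<close> and
    \<open>z\<close> start together.\<close>
  have link: "A.proc 1 (x0 - xs) w n
      = (case acsgd_state \<alpha> \<beta> x0 w n of (x, y, z) \<Rightarrow> (real (n + 1) *\<^sub>R (x - xs) - (z - xs), z - xs))" for w n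
  proof (induction n)
    case (Suc n)
    obtain x y z where xyz: "acsgd_state \<alpha> \<beta> x0 w n = (x, y, z)" by (metis prod_cases3)
    let ?a = "fst (w n)" and ?b = "snd (w n)"
    let ?\<theta> = "(real (n + 1) *\<^sub>R (x - xs) - (z - xs), z - xs)"
    have "?a \<bullet> (real (n + 1) *\<^sub>R (x - xs)) - 1 * (real n + 1) * \<eta> (w n) = real (n + 1) * (?a \<bullet> x - ?b)"
      by (simp add: \<eta>_def inner_diff_right inner_commute algebra_simps)
    then have g: "A.grad 1 n ?\<theta> (w n) = real (n + 1) *\<^sub>R ((?a \<bullet> x - ?b) *\<^sub>R ?a)"
      by (simp add: A.grad_def)
    have "A.proc 1 (x0 - xs) w (Suc n) = A.step 1 n ?\<theta> (w n)" using Suc by (simp add: xyz)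
    also have "\<dots> = (real (n + 1) *\<^sub>R (x - xs) - (\<beta> * real (n + 1)) *\<^sub>R ((?a \<bullet> x - ?b) *\<^sub>R ?a),
        z - xs - (\<alpha> * real (n + 1)) *\<^sub>R ((?a \<bullet> x - ?b) *\<^sub>R ?a))"
      unfolding A.step_def g by simp
    finally have p: "A.proc 1 (x0 - xs) w (Suc n)
        = (real (n + 1) *\<^sub>R (x - xs) - (\<beta> * real (n + 1)) *\<^sub>R ((?a \<bullet> x - ?b) *\<^sub>R ?a),
        z - xs - (\<alpha> * real (n + 1)) *\<^sub>R ((?a \<bullet> x - ?b) *\<^sub>R ?a))" .
    define g where "g = (?a \<bullet> x - ?b) *\<^sub>R ?a"
    let ?z' = "z - (\<alpha> * real (n + 1)) *\<^sub>R g"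
    define x' where "x' = (1 / real (n + 2)) *\<^sub>R (real (n + 1) *\<^sub>R (x - \<beta> *\<^sub>R g) + ?z')"
    have st: "acsgd_state \<alpha> \<beta> x0 w (Suc n) = (x', x - \<beta> *\<^sub>R g, ?z')"
      by (simp add: xyz g_def x'_def Let_def)
    have "real (Suc n + 1) *\<^sub>R (x' - xs) = real (n + 1) *\<^sub>R (x - \<beta> *\<^sub>R g) + ?z' - real (n + 2) *\<^sub>R xs"
      by (simp add: x'_def scaleR_diff_right)
    also have "real (n + 2) *\<^sub>R xs = real (n + 1) *\<^sub>R xs + xs"
    proof -
      have "real (n + 2) = real (n + 1) + 1" by simp
      then show ?thesis by (simp only: scaleR_left_distrib scaleR_one)
    qed
    finally have x': "real (Suc n + 1) *\<^sub>R (x' - xs)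
        = real (n + 1) *\<^sub>R (x - \<beta> *\<^sub>R g) + ?z' - (real (n + 1) *\<^sub>R xs + xs)" .
    show ?case unfolding p st g_def[symmetric] prod.case x'
      by (simp add: scaleR_diff_right mult.commute)
  qed simp
  have pos_err: "fst (A.proc 1 (x0 - xs) w t) + snd (A.proc 1 (x0 - xs) w t)
      = (real t + 1) *\<^sub>R (acsgd_x \<alpha> \<beta> x0 w t - xs)" for w
    unfolding link by (simp add: acsgd_x_def case_prod_beta add.commute)
  have R: "risk rho (acsgd_x \<alpha> \<beta> x0 w t) - risk rho xs
      = (\<Sum>f\<in>B. lam f * ((fst (A.proc 1 (x0 - xs) w t) + snd (A.proc 1 (x0 - xs) w t)) \<bullet> f)^2) / (2 * (real t + 1)^2)" for w
  proof -
    have "(\<Sum>f\<in>B. lam f * (((real t + 1) *\<^sub>R y) \<bullet> f)^2) = (real t + 1)^2 * (\<Sum>f\<in>B. lam f * (y \<bullet> f)^2)" for y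
      by (simp add: sum_distrib_left power_mult_distrib mult_ac)
    then show ?thesis unfolding pos_err excess by simp
  qed

  \<comment> \<open>The expected excess risk\<close>
  have "(\<integral>\<^sup>+ w. ennreal (risk rho (acsgd_x \<alpha> \<beta> x0 w t) - risk rho xs) \<partial>(\<Pi>\<^sub>M i\<in>(UNIV::nat set). rho))
      = ennreal (\<integral>w. risk rho (acsgd_x \<alpha> \<beta> x0 w t) - risk rho xs \<partial>(\<Pi>\<^sub>M i\<in>(UNIV::nat set). rho))"
  proof (rule nn_integral_eq_integral)
    show "integrable (\<Pi>\<^sub>M i\<in>(UNIV::nat set). rho) (\<lambda>w. risk rho (acsgd_x \<alpha> \<beta> x0 w t) - risk rho xs)"
      unfolding R by (intro integrable_divide_zero A.energy_integrable)
  qed (use xs_min in auto)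
  also have "(\<integral>w. risk rho (acsgd_x \<alpha> \<beta> x0 w t) - risk rho xs \<partial>(\<Pi>\<^sub>M i\<in>(UNIV::nat set). rho))
      = A.energy 1 (x0 - xs) t / (2 * (real t + 1)^2)"
    unfolding R A.energy_def by simp
  also have "\<dots> \<le> min (3 / (\<alpha> * real t ^ 2)) (24 / (\<beta> * real t)) * (norm (x0 - xs))^2 + 3 * G * \<sigma>^2"
    using \<kappa> by (intro A.last_iterate_bound \<alpha>_pos \<beta>_pos ab small \<kappa>G G_def t_pos) auto
  also have "3 * G * \<sigma>^2 \<le> 2 * (3 * G) * \<sigma>^2"
  proof -
    have "0 \<le> trace H" unfolding trace_H using lam_pos by (intro sum_nonneg) (auto intro: less_imp_le)
    then have "0 \<le> 3 * G" unfolding G using \<alpha>_pos \<beta>_pos d by simp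
    then show ?thesis by (intro mult_right_mono) auto
  qed
  finally show ?thesis
    unfolding G by (simp add: H_def d_def ennreal_leI add.commute)
qed

end
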